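(* The following problem is undecidable: given a semilinear (not necessarily equivariant) deterministic finite automaton with the integer atoms, decide whether the language it accepts is empty.
   Context: Integer atoms: the atoms are the integers $\mathbb{Z}$ with the successor function; the automorphisms are exactly the translations $x\mapsto x+z$, $z\in\mathbb{Z}$, acting hereditarily on sets built from atoms. A set is equivariant if invariant under all translations; an equivariant set is orbit-finite if it is a finite union of orbits $\{x\cdot\pi\}$. For $k\ge1$, $\mathbb{Z}_k$ is the integers modulo $k$ with translations acting by addition, $\mathbb{Z}_0=\mathbb{Z}$; every equivariant single-orbit set is equivariantly isomorphic to some $\mathbb{Z}_k$. A monomial set is a finite product of equivariant single-orbit sets, a polynomial set a finite disjoint union of monomials. A subset of $\mathbb{Z}^m$ is semilinear if Presburger-definable; every subset of $\mathbb{Z}_k$ ($k\ge1$) is semilinear; subsets of general monomials (and polynomial sets) are called semilinear if they are semilinear after transporting them along equivariant isomorphisms to disjoint unions of monomials $\mathbb{Z}^m$, $\mathbb{Z}_k$ (via $\mathbb{Z}_k\times\mathbb{Z}\cong k$ copies of $\mathbb{Z}$, $\mathbb{Z}_k\times\mathbb{Z}_l\cong\mathbb{Z}_{\mathrm{lcm}(k,l)}$) and checking componentwise. A DFA with atoms consists of an orbit-finite equivariant alphabet $A$, an orbit-finite equivariant state set $Q$, a transition function $\delta:Q\times A\to Q$, an initial state $q_0\in Q$ and accepting states $F\subseteq Q$ (here $\delta$, $q_0$, $F$ need not be equivariant; with integer atoms every set is finitely supported). It is semilinear if $\delta$ is a semilinear subset of $Q\times A\times Q$. It accepts finite words over $A$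 in the usual way. *)

theory Defs
  imports
    "HOL-Algebra.Group_Action"
    "HOL-Algebra.Elementary_Groups"
    "HOL-Library.Nat_Bijection"
begin

section \<open>Sets with integer atoms\<close>

text \<open>
  The automorphisms of the integer atoms are the translations, so an equivariant set with atoms is
  a set with an action of the additive group of integers.
\<close>

record 'a atom_set =
  elems :: "'a set"
  act :: "int \<Rightarrow> 'a \<Rightarrow> 'a"

definition orbit_finite :: "'a atom_set \<Rightarrow> bool" where
  "orbit_finite X \<longleftrightarrow>
     group_action integer_group (elems X) (act X) \<and>
     finite (orbits integer_group (elems X) (act X))"

definition equivariant_iso :: "('a \<Rightarrow> 'b) \<Rightarrow> 'a atom_set \<Rightarrow> 'b atom_set \<Rightarrow> bool" where
  "equivariant_iso h X Y \<longleftrightarrow>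
     bij_betw h (elems X) (elems Y) \<and> (\<forall>z. \<forall>x\<in>elems X. h (act X z x) = act Y z (h x))"

text \<open>
  Canonical representatives of the integers modulo \<open>k\<close>. Since \<open>x mod 0 = x\<close>, the modulus \<open>0\<close>
  gives all integers.
\<close>

definition Zmod :: "nat \<Rightarrow> int set" where
  "Zmod k = {x. x mod int k = x}"

text \<open>The disjoint union of the single-orbit sets \<open>Zmod (ks ! i)\<close>, tagged by \<open>i\<close>.\<close>

definition orbit_sum :: "nat list \<Rightarrow> (nat \<times> int) atom_set" where
  "orbit_sum ks =
     (let E = {(i, x). i < length ks \<and> x \<in> Zmod (ks ! i)}
      in \<lparr>elems = E, act = (\<lambda>z. restrict (\<lambda>(i, x). (i, (x + z) mod int (ks ! i))) E)\<rparr>)"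

section \<open>Presburger arithmetic and semilinear sets\<close>

datatype pterm = Const int | Var nat | Add pterm pterm | Mul int pterm

text \<open>Variables are de Bruijn indices: \<open>Ex\<close> binds variable \<open>0\<close> of its body.\<close>

datatype pform = Eq pterm pterm | Less pterm pterm | Neg pform | Conj pform pform | Ex pform

fun tval :: "(nat \<Rightarrow> int) \<Rightarrow> pterm \<Rightarrow> int" where
  "tval e (Const c) = c"
| "tval e (Var n) = e n"
| "tval e (Add s t) = tval e s + tval e t"
| "tval e (Mul c t) = c * tval e t"

fun holds :: "(nat \<Rightarrow> int) \<Rightarrow> pform \<Rightarrow> bool" where
  "holds e (Eq s t) \<longleftrightarrow> tval e s = tval e t"
| "holds e (Less s t) \<longleftrightarrow> tval e s < tval e t"
| "holds e (Neg p) \<longleftrightarrow> \<not> holds e p"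
| "holds e (Conj p q) \<longleftrightarrow> holds e p \<and> holds e q"
| "holds e (Ex p) \<longleftrightarrow> (\<exists>x. holds (case_nat x e) p)"

text \<open>Free variables outside the tuple are read as the constant \<open>0\<close>.\<close>

definition tuple_env :: "int list \<Rightarrow> nat \<Rightarrow> int" where
  "tuple_env zs n = (if n < length zs then zs ! n else 0)"

definition presburger_definable :: "nat \<Rightarrow> int list set \<Rightarrow> bool" where
  "presburger_definable m S \<longleftrightarrow> (\<exists>p. S = {zs. length zs = m \<and> holds (tuple_env zs) p})"

definition monomial :: "nat list \<Rightarrow> int list set" where
  "monomial ks = {xs. list_all2 (\<lambda>k x. x \<in> Zmod k) ks xs}"

text \<open>
  If some modulus in \<open>ks\<close> is \<open>0\<close>, the monomial with moduli \<open>ks\<close> is a disjoint union of copies of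
  a power of the integers. The isomorphism iterates the one that sends a pair \<open>(x, z)\<close> of an
  integer \<open>x\<close> modulo \<open>k\<close> and an integer \<open>z\<close> to the element \<open>z\<close> of the copy numbered
  \<open>(x - z) mod k\<close>; here \<open>z\<close> is always the first integer coordinate. It maps \<open>xs\<close> to the element
  \<open>free_part ks xs\<close> of the copy \<open>copy_index ks xs\<close>.
\<close>

definition free_part :: "nat list \<Rightarrow> int list \<Rightarrow> int list" where
  "free_part ks xs = map snd (filter (\<lambda>(k, x). k = 0) (zip ks xs))"

definition copy_index :: "nat list \<Rightarrow> int list \<Rightarrow> int list" where
  "copy_index ks xs =
     (let z = (case free_part ks xs of [] \<Rightarrow> 0 | z # _ \<Rightarrow> z)
      in map (\<lambda>(k, x). (x - z) mod int k) (filter (\<lambda>(k, x). k \<noteq> 0) (zip ks xs)))"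

text \<open>
  If no modulus is \<open>0\<close>, the monomial is a disjoint union of integers modulo positive numbers, of
  which all subsets are semilinear.
\<close>

definition semilinear_monomial :: "nat list \<Rightarrow> int list set \<Rightarrow> bool" where
  "semilinear_monomial ks S \<longleftrightarrow>
     S \<subseteq> monomial ks \<and>
     (0 \<in> set ks \<longrightarrow>
       (\<forall>c. presburger_definable (count_list ks 0) (free_part ks ` {xs \<in> S. copy_index ks xs = c})))"

text \<open>
  The product of the sets \<open>orbit_sum ks\<close>, for \<open>ks\<close> in the list \<open>kss\<close>. It is the polynomial set whose
  monomials are indexed by the lists \<open>is\<close> of orbit indices.
\<close>

definition poly_prod :: "nat list list \<Rightarrow> (nat \<times> int) list set" where
  "poly_prod kss = {ps. list_all2 (\<lambda>ks p. p \<in> elems (orbit_sum ks)) kss ps}"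

definition moduli :: "nat list list \<Rightarrow> nat list \<Rightarrow> nat list" where
  "moduli kss is = map2 (!) kss is"

definition semilinear :: "nat list list \<Rightarrow> (nat \<times> int) list set \<Rightarrow> bool" where
  "semilinear kss S \<longleftrightarrow>
     S \<subseteq> poly_prod kss \<and>
     (\<forall>is. list_all2 (\<lambda>ks i. i < length ks) kss is \<longrightarrow>
       semilinear_monomial (moduli kss is) (map snd ` {ps \<in> S. map fst ps = is}))"

section \<open>Deterministic automata with atoms\<close>

text \<open>The transition function is represented by its graph.\<close>

record ('q, 'a) atom_dfa =
  states :: "'q atom_set"
  alphabet :: "'a atom_set"
  trans_graph :: "('q \<times> 'a \<times> 'q) set"
  init :: 'q
  accepting :: "'q set"

definition is_dfa :: "('q, 'a) atom_dfa \<Rightarrow> bool" where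
  "is_dfa M \<longleftrightarrow>
     orbit_finite (alphabet M) \<and> orbit_finite (states M) \<and>
     trans_graph M \<subseteq> elems (states M) \<times> elems (alphabet M) \<times> elems (states M) \<and>
     (\<forall>q\<in>elems (states M). \<forall>a\<in>elems (alphabet M). \<exists>!p. (q, a, p) \<in> trans_graph M) \<and>
     init M \<in> elems (states M) \<and> accepting M \<subseteq> elems (states M)"

definition semilinear_dfa :: "('q, 'a) atom_dfa \<Rightarrow> bool" where
  "semilinear_dfa M \<longleftrightarrow>
     is_dfa M \<and>
     (\<exists>ks ls g h.
        equivariant_iso g (states M) (orbit_sum ks) \<and>
        equivariant_iso h (alphabet M) (orbit_sum ls) \<and>
        semilinear [ks, ls, ks] ((\<lambda>(q, a, p). [g q, h a, g p]) ` trans_graph M))"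

definition step :: "('q, 'a) atom_dfa \<Rightarrow> 'q \<Rightarrow> 'a \<Rightarrow> 'q" where
  "step M q a = (THE p. (q, a, p) \<in> trans_graph M)"

definition language :: "('q, 'a) atom_dfa \<Rightarrow> 'a list set" where
  "language M = {w \<in> lists (elems (alphabet M)). foldl (step M) (init M) w \<in> accepting M}"

section \<open>Finite presentations\<close>

text \<open>
  An entry \<open>(is, c, p)\<close> of a table contributes the subset of copy \<open>c\<close> of monomial \<open>is\<close> that is
  defined by the formula \<open>p\<close>. For a monomial without integer coordinates the copies are single
  points and \<open>p\<close> is evaluated as a sentence.
\<close>

type_synonym table = "(nat list \<times> int list \<times> pform) list"

definition table_set :: "nat list list \<Rightarrow> table \<Rightarrow> (nat \<times> int) list set" where
  "table_set kss T =
     {ps \<in> poly_prod kss. \<exists>(is, c, p) \<in> set T.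
        map fst ps = is \<and>
        copy_index (moduli kss is) (map snd ps) = c \<and>
        holds (tuple_env (free_part (moduli kss is) (map snd ps))) p}"

datatype dfa_code = DFA_Code
  (state_orbits: "nat list")
  (letter_orbits: "nat list")
  (trans_table: table)
  (init_code: "nat \<times> int")
  (accepting_table: table)

definition dfa_of :: "dfa_code \<Rightarrow> (nat \<times> int, nat \<times> int) atom_dfa" where
  "dfa_of C =
     \<lparr>states = orbit_sum (state_orbits C),
      alphabet = orbit_sum (letter_orbits C),
      trans_graph = {(q, a, p).
        [q, a, p] \<in> table_set [state_orbits C, letter_orbits C, state_orbits C] (trans_table C)},
      init = init_code C,
      accepting = {q. [q] \<in> table_set [state_orbits C] (accepting_table C)}\<rparr>"

fun term_encode :: "pterm \<Rightarrow> nat" where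
  "term_encode (Const c) = prod_encode (0, int_encode c)"
| "term_encode (Var n) = prod_encode (1, n)"
| "term_encode (Add s t) = prod_encode (2, prod_encode (term_encode s, term_encode t))"
| "term_encode (Mul c t) = prod_encode (3, prod_encode (int_encode c, term_encode t))"

fun form_encode :: "pform \<Rightarrow> nat" where
  "form_encode (Eq s t) = prod_encode (0, prod_encode (term_encode s, term_encode t))"
| "form_encode (Less s t) = prod_encode (1, prod_encode (term_encode s, term_encode t))"
| "form_encode (Neg p) = prod_encode (2, form_encode p)"
| "form_encode (Conj p q) = prod_encode (3, prod_encode (form_encode p, form_encode q))"
| "form_encode (Ex p) = prod_encode (4, form_encode p)"

definition table_encode :: "table \<Rightarrow> nat" where
  "table_encode T =
     list_encode (map (\<lambda>(is, c, p).
       prod_encode (list_encode is,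
         prod_encode (list_encode (map int_encode c), form_encode p))) T)"

fun dfa_encode :: "dfa_code \<Rightarrow> nat" where
  "dfa_encode (DFA_Code ks ls T q F) =
     list_encode [list_encode ks, list_encode ls, table_encode T,
       prod_encode (fst q, int_encode (snd q)), table_encode F]"

section \<open>Decidability\<close>

text \<open>
  Kleene's partial recursive functions. Arities are not part of the syntax: \<open>rec_eval f xs y\<close>
  holds if \<open>f\<close>, applied to the argument list \<open>xs\<close>, is defined with value \<open>y\<close>.
\<close>

datatype recf =
  RZero | RSucc | RProj nat | RComp recf "recf list" | RPrim recf recf | RMu recf

inductive rec_eval :: "recf \<Rightarrow> nat list \<Rightarrow> nat \<Rightarrow> bool" where
  zero: "rec_eval RZero xs 0"
| succ: "rec_eval RSucc [x] (Suc x)"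
| proj: "i < length xs \<Longrightarrow> rec_eval (RProj i) xs (xs ! i)"
| comp: "list_all2 (\<lambda>g y. rec_eval g xs y) gs ys \<Longrightarrow> rec_eval f ys z \<Longrightarrow> rec_eval (RComp f gs) xs z"
| prim_0: "rec_eval f xs y \<Longrightarrow> rec_eval (RPrim f g) (0 # xs) y"
| prim_Suc: "rec_eval (RPrim f g) (n # xs) y \<Longrightarrow> rec_eval g (n # y # xs) z \<Longrightarrow>
    rec_eval (RPrim f g) (Suc n # xs) z"
| mu: "rec_eval f (n # xs) 0 \<Longrightarrow> (\<forall>m<n. \<exists>y. rec_eval f (m # xs) (Suc y)) \<Longrightarrow>
    rec_eval (RMu f) xs n"

text \<open>
  Decidability of the problem \<open>P\<close> for instances in \<open>I\<close>, given to the algorithm through the encoding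
  \<open>enc\<close>. The algorithm must terminate with the correct answer on every instance; its behaviour on
  other inputs is irrelevant.
\<close>

definition decidable :: "('c \<Rightarrow> nat) \<Rightarrow> 'c set \<Rightarrow> ('c \<Rightarrow> bool) \<Rightarrow> bool" where
  "decidable enc I P \<longleftrightarrow> (\<exists>f. \<forall>c\<in>I. rec_eval f [enc c] (if P c then 1 else 0))"

section \<open>Adequacy of the definitions\<close>

inductive_cases rec_eval_elims:
  "rec_eval RZero xs y" "rec_eval RSucc xs y" "rec_eval (RProj i) xs y"
  "rec_eval (RComp f gs) xs y" "rec_eval (RPrim f g) (0 # xs) y"
  "rec_eval (RPrim f g) (Suc n # xs) y" "rec_eval (RMu f) xs y"

lemma rec_eval_deterministic: "rec_eval f xs y \<Longrightarrow> rec_eval f xs z \<Longrightarrow> y = z"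
proof (induction arbitrary: z rule: rec_eval.induct)
  case (zero xs)
  then show ?case by (rule rec_eval_elims(1)) simp
next
  case (succ x)
  then show ?case by (rule rec_eval_elims(2)) simp
next
  case (proj i xs)
  from proj.prems show ?case by (rule rec_eval_elims(3)) simp
next
  case (comp xs gs ys f z')
  from comp.prems obtain ys' where ys': "list_all2 (\<lambda>g y. rec_eval g xs y) gs ys'" "rec_eval f ys' z"
    by (rule rec_eval_elims(4))
  have "ys = ys'"
    using comp.IH(1) ys'(1) by (auto simp: list_all2_conv_all_nth intro!: nth_equalityI)
  with comp.IH(2) ys'(2) show ?case by blast
next
  case (prim_0 f xs y g)
  from prim_0.prems show ?case by (rule rec_eval_elims(5)) (rule prim_0.IH)
next
  case (prim_Suc f g n xs y z')
  from prim_Suc.prems show ?case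
    by (rule rec_eval_elims(6)) (use prim_Suc.IH in blast)
next
  case (mu f n xs)
  from mu.prems have z: "rec_eval f (z # xs) 0" "\<forall>m<z. \<exists>y. rec_eval f (m # xs) (Suc y)"
    by (rule rec_eval_elims(7), simp)+
  show ?case
  proof (cases n z rule: linorder_cases)
    case less
    with z(2) mu.IH(1) show ?thesis by blast
  next
    case greater
    with z(1) mu.IH(2) show ?thesis by blast
  qed
qed

lemma term_encode_inj: "term_encode s = term_encode t \<Longrightarrow> s = t"
proof (induction s arbitrary: t)
  case (Const c) then show ?case by (cases t) (auto simp: prod_encode_eq int_encode_eq)
next
  case (Var n) then show ?case by (cases t) (auto simp: prod_encode_eq)
next
  case (Add s1 s2) then show ?case by (cases t) (auto simp: prod_encode_eq)
next
  case (Mul c s) then show ?case by (cases t) (auto simp: prod_encode_eq int_encode_eq)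
qed

lemma form_encode_inj: "form_encode p = form_encode q \<Longrightarrow> p = q"
proof (induction p arbitrary: q)
  case (Eq s t) then show ?case by (cases q) (auto simp: prod_encode_eq dest: term_encode_inj)
next
  case (Less s t) then show ?case by (cases q) (auto simp: prod_encode_eq dest: term_encode_inj)
next
  case (Neg p) then show ?case by (cases q) (auto simp: prod_encode_eq)
next
  case (Conj p1 p2) then show ?case by (cases q) (auto simp: prod_encode_eq)
next
  case (Ex p) then show ?case by (cases q) (auto simp: prod_encode_eq)
qed

lemma table_encode_inj: "table_encode T = table_encode U \<Longrightarrow> T = U"
  unfolding table_encode_def list_encode_eq
  by (rule map_injective, assumption)
    (auto simp: inj_def prod_encode_eq list_encode_eq inj_map_eq_map inj_int_encode
      dest: form_encode_inj dest!: map_injective[OF _ inj_int_encode])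

lemma inj_dfa_encode: "inj dfa_encode"
proof (rule injI)
  fix C D assume "dfa_encode C = dfa_encode D"
  then show "C = D"
    by (cases C; cases D)
      (auto simp: list_encode_eq prod_encode_eq int_encode_eq prod_eq_iff simp del: list_encode.simps
        dest: table_encode_inj)
qed

lemma elems_orbit_sum: "elems (orbit_sum ks) = {(i, x). i < length ks \<and> x \<in> Zmod (ks ! i)}"
  by (simp add: orbit_sum_def Let_def)

lemma act_orbit_sum:
  "act (orbit_sum ks) z = restrict (\<lambda>(i, x). (i, (x + z) mod int (ks ! i))) (elems (orbit_sum ks))"
  by (simp add: orbit_sum_def Let_def)

lemma Zmod_mod: "x mod int k \<in> Zmod k"
  by (simp add: Zmod_def)

lemma act_orbit_sum_closed: "p \<in> elems (orbit_sum ks) \<Longrightarrow> act (orbit_sum ks) z p \<in> elems (orbit_sum ks)"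
  by (auto simp: act_orbit_sum elems_orbit_sum Zmod_mod)

lemma act_orbit_sum_add:
  "p \<in> elems (orbit_sum ks) \<Longrightarrow>
    act (orbit_sum ks) z (act (orbit_sum ks) w p) = act (orbit_sum ks) (z + w) p"
  by (auto simp: act_orbit_sum elems_orbit_sum Zmod_mod mod_simps algebra_simps)

lemma act_orbit_sum_0: "p \<in> elems (orbit_sum ks) \<Longrightarrow> act (orbit_sum ks) 0 p = p"
  by (auto simp: act_orbit_sum elems_orbit_sum Zmod_def)

lemma orbit_finite_orbit_sum: "orbit_finite (orbit_sum ks)"
proof -
  let ?E = "elems (orbit_sum ks)" and ?a = "act (orbit_sum ks)"
  have bij: "?a z \<in> Bij ?E" for z
  proof -
    have "bij_betw (?a z) ?E ?E"
      by (rule bij_betw_byWitness[where f' = "?a (- z)"])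
        (auto simp: act_orbit_sum_closed act_orbit_sum_add act_orbit_sum_0 simp del: split_paired_All)
    then show ?thesis by (simp add: Bij_def act_orbit_sum)
  qed
  have "?a (z + w) = compose ?E (?a z) (?a w)" for z w
    by (rule extensionalityI[where A = ?E])
      (auto simp: compose_def act_orbit_sum_add simp del: split_paired_All, simp add: act_orbit_sum)
  then have "?a \<in> hom integer_group (BijGroup ?E)"
    by (auto simp: hom_def BijGroup_def bij)
  then have ga: "group_action integer_group ?E ?a"
    by (simp add: group_action_def group_hom_def group_hom_axioms_def group_BijGroup)
  have "orbit integer_group ?a (i, x) = orbit integer_group ?a (i, 0)" if "(i, x) \<in> ?E" for i x
  proof -
    have e: "(i, 0) \<in> ?E" and x: "?a x (i, 0) = (i, x)"
      using that by (auto simp: act_orbit_sum elems_orbit_sum Zmod_def)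
    have "?a z (i, x) = ?a (z + x) (i, 0)" for z using act_orbit_sum_add[OF e, of z x] x by simp
    moreover have "?a z (i, 0) = ?a (z - x) (i, x)" for z
      using act_orbit_sum_add[OF e, of "z - x" x] x by simp
    ultimately have "range (\<lambda>z. ?a z (i, x)) = range (\<lambda>z. ?a z (i, 0))"
      by (metis (no_types, lifting) image_eqI image_subsetI rangeI subset_antisym)
    then show ?thesis by (simp add: orbit_def full_SetCompr_eq)
  qed
  then have "orbits integer_group ?E ?a \<subseteq> (\<lambda>i. orbit integer_group ?a (i, 0)) ` {..<length ks}"
    by (fastforce simp: orbits_def elems_orbit_sum)
  then have "finite (orbits integer_group ?E ?a)" by (rule finite_subset) simp
  with ga show ?thesis by (simp add: orbit_finite_def)
qed

text \<open>The tables present exactly the semilinear sets.\<close>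

definition residues_rel :: "int \<Rightarrow> nat list \<Rightarrow> int list \<Rightarrow> int list" where
  "residues_rel z ks xs = map (\<lambda>(k, x). (x - z) mod int k) (filter (\<lambda>(k, x). k \<noteq> 0) (zip ks xs))"

lemma copy_index_alt:
  "copy_index ks xs = residues_rel (case free_part ks xs of [] \<Rightarrow> 0 | z # _ \<Rightarrow> z) ks xs"
  by (simp add: copy_index_def residues_rel_def Let_def)

lemma parts_Cons:
  "free_part (k # ks) (x # xs) = (if k = 0 then x # free_part ks xs else free_part ks xs)"
  "residues_rel z (k # ks) (x # xs) =
     (if k = 0 then residues_rel z ks xs else ((x - z) mod int k) # residues_rel z ks xs)"
  by (simp_all add: free_part_def residues_rel_def)

lemma parts_Nil: "free_part [] [] = []" "residues_rel z [] [] = []"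
  by (simp_all add: free_part_def residues_rel_def)

lemma Zmod_diff_cancel:
  assumes "x \<in> Zmod k" "y \<in> Zmod k" "(x - z) mod int k = (y - z) mod int k"
  shows "x = y"
proof -
  have "(x - z + z) mod int k = (y - z + z) mod int k" using assms(3) by (metis mod_add_left_eq)
  then show ?thesis using assms(1,2) by (simp add: Zmod_def)
qed

lemma parts_inj:
  assumes "list_all2 (\<lambda>k x. x \<in> Zmod k) ks xs" "list_all2 (\<lambda>k x. x \<in> Zmod k) ks ys"
    "free_part ks xs = free_part ks ys" "residues_rel z ks xs = residues_rel z ks ys"
  shows "xs = ys"
  using assms
proof (induction ks xs arbitrary: ys rule: list_all2_induct)
  case (Cons k ks x xs)
  then obtain y ys' where ys: "ys = y # ys'" "y \<in> Zmod k" "list_all2 (\<lambda>k x. x \<in> Zmod k) ks ys'"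
    by (auto simp: list_all2_Cons1)
  show ?case
    using Cons.IH[OF ys(3)] Cons.prems Cons.hyps(1) ys(2)
    by (auto simp: ys(1) parts_Cons split: if_splits dest: Zmod_diff_cancel)
qed simp

lemma monomial_inj:
  assumes "xs \<in> monomial ks" "ys \<in> monomial ks"
    "free_part ks xs = free_part ks ys" "copy_index ks xs = copy_index ks ys"
  shows "xs = ys"
  using assms parts_inj unfolding monomial_def copy_index_alt by (metis mem_Collect_eq)

lemma parts_surj:
  assumes "length zs = count_list ks 0" "list_all2 (\<lambda>k c. c \<in> Zmod k) (filter (\<lambda>k. k \<noteq> 0) ks) cs"
  shows "\<exists>xs. list_all2 (\<lambda>k x. x \<in> Zmod k) ks xs \<and> free_part ks xs = zs \<and> residues_rel z ks xs = cs"
  using assms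
proof (induction ks arbitrary: zs cs)
  case Nil
  then show ?case by (auto simp: parts_Nil)
next
  case (Cons k ks)
  show ?case
  proof (cases "k = 0")
    case True
    then obtain x zs' where zs: "zs = x # zs'" using Cons.prems(1) by (cases zs) auto
    from True zs Cons.prems obtain xs where
      "list_all2 (\<lambda>k x. x \<in> Zmod k) ks xs" "free_part ks xs = zs'" "residues_rel z ks xs = cs"
      using Cons.IH[of zs' cs] by auto
    then show ?thesis using True zs by (intro exI[of _ "x # xs"]) (simp add: parts_Cons Zmod_def)
  next
    case False
    then obtain c cs' where cs: "cs = c # cs'" "c \<in> Zmod k"
      "list_all2 (\<lambda>k c. c \<in> Zmod k) (filter (\<lambda>k. k \<noteq> 0) ks) cs'"
      using Cons.prems(2) by (auto simp: list_all2_Cons1)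
    from False Cons.prems(1) Cons.IH[of zs cs'] cs obtain xs where
      "list_all2 (\<lambda>k x. x \<in> Zmod k) ks xs" "free_part ks xs = zs" "residues_rel z ks xs = cs'"
      by auto
    then show ?thesis using False cs
      by (intro exI[of _ "((c + z) mod int k) # xs"]) (simp add: parts_Cons Zmod_def mod_simps)
  qed
qed

lemma free_part_length: "list_all2 P ks xs \<Longrightarrow> length (free_part ks xs) = count_list ks 0"
  by (induction rule: list_all2_induct) (auto simp: parts_Cons parts_Nil)

lemma monomial_free_part_length: "xs \<in> monomial ks \<Longrightarrow> length (free_part ks xs) = count_list ks 0"
  using free_part_length unfolding monomial_def by blast

lemma residues_rel_range:
  "list_all2 P ks xs \<Longrightarrow> list_all2 (\<lambda>k c. c \<in> Zmod k) (filter (\<lambda>k. k \<noteq> 0) ks) (residues_rel z ks xs)"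
  by (induction rule: list_all2_induct) (auto simp: parts_Cons parts_Nil Zmod_mod)

lemma monomial_image:
  assumes "\<exists>xs\<in>monomial ks. copy_index ks xs = c"
  shows "free_part ks ` {xs \<in> monomial ks. copy_index ks xs = c \<and> P (free_part ks xs)} =
    {zs. length zs = count_list ks 0 \<and> P zs}"
proof (intro equalityI subsetI)
  fix zs assume "zs \<in> {zs. length zs = count_list ks 0 \<and> P zs}"
  moreover obtain xs' where "list_all2 (\<lambda>k x. x \<in> Zmod k) ks xs'" "copy_index ks xs' = c"
    using assms by (auto simp: monomial_def)
  then have "list_all2 (\<lambda>k c. c \<in> Zmod k) (filter (\<lambda>k. k \<noteq> 0) ks) c"
    using residues_rel_range by (auto simp: copy_index_alt)
  ultimately obtain xs where "list_all2 (\<lambda>k x. x \<in> Zmod k) ks xs" "free_part ks xs = zs"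
    "residues_rel (case zs of [] \<Rightarrow> 0 | z # _ \<Rightarrow> z) ks xs = c" "P zs"
    using parts_surj by blast
  then show "zs \<in> free_part ks ` {xs \<in> monomial ks. copy_index ks xs = c \<and> P (free_part ks xs)}"
    by (auto simp: monomial_def copy_index_alt)
qed (auto simp: monomial_def free_part_length)

lemma poly_prod_iff:
  "ps \<in> poly_prod kss \<longleftrightarrow>
    list_all2 (\<lambda>ks i. i < length ks) kss (map fst ps) \<and> map snd ps \<in> monomial (moduli kss (map fst ps))"
proof (induction kss arbitrary: ps)
  case Nil
  then show ?case by (auto simp: poly_prod_def monomial_def moduli_def)
next
  case (Cons ks kss)
  show ?case
  proof (cases ps)
    case (Cons p ps')
    then show ?thesis
      using Cons.IH[of ps'] by (cases p) (auto simp: poly_prod_def monomial_def moduli_def elems_orbit_sum)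
  qed (simp add: poly_prod_def)
qed

lemma component_eq:
  assumes "list_all2 (\<lambda>ks i. i < length ks) kss is"
  shows "map snd ` {ps \<in> poly_prod kss. map fst ps = is \<and> P (map snd ps)} =
    {xs \<in> monomial (moduli kss is). P xs}" (is "?L = ?R")
proof (rule equalityI; rule subsetI)
  fix xs assume "xs \<in> ?R"
  then have xs: "xs \<in> monomial (moduli kss is)" "P xs" by simp_all
  have "length xs = length (moduli kss is)"
    using xs(1) list_all2_lengthD unfolding monomial_def by fastforce
  then have "length xs = length is"
    using list_all2_lengthD[OF assms] by (simp add: moduli_def)
  then have zip: "map fst (zip is xs) = is" "map snd (zip is xs) = xs" by simp_all
  have "zip is xs \<in> poly_prod kss" unfolding poly_prod_iff zip using assms xs(1) by (rule conjI)
  then show "xs \<in> ?L" using zip xs(2) by (intro image_eqI[where x = "zip is xs"]) simp_all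
next
  fix xs assume "xs \<in> ?L"
  then obtain ps where "ps \<in> poly_prod kss" "map fst ps = is" "P (map snd ps)" "xs = map snd ps"
    by blast
  then show "xs \<in> ?R" using poly_prod_iff[of ps kss] by simp
qed

lemma holds_finite_disj: "\<exists>p. \<forall>e. holds e p \<longleftrightarrow> (\<exists>q\<in>set qs. holds e q)"
proof (induction qs)
  case Nil
  show ?case by (rule exI[of _ "Less (Const 0) (Const 0)"]) simp
next
  case (Cons q qs)
  then obtain p where p: "\<forall>e. holds e p \<longleftrightarrow> (\<exists>q\<in>set qs. holds e q)" by blast
  show ?case by (rule exI[of _ "Neg (Conj (Neg q) (Neg p))"]) (simp add: p)
qed

lemma presburger_definable_empty: "presburger_definable m {}"
  unfolding presburger_definable_def by (rule exI[of _ "Less (Const 0) (Const 0)"]) simp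

lemma semilinear_table_set: "semilinear kss (table_set kss T)"
  unfolding semilinear_def
proof (intro conjI allI impI)
  show "table_set kss T \<subseteq> poly_prod kss" by (auto simp: table_set_def)
next
  fix "is" assume valid: "list_all2 (\<lambda>ks i. i < length ks) kss is"
  let ?ks = "moduli kss is"
  let ?Q = "\<lambda>xs. \<exists>(j, c, p) \<in> set T. is = j \<and> copy_index ?ks xs = c \<and> holds (tuple_env (free_part ?ks xs)) p"
  have "{ps \<in> table_set kss T. map fst ps = is} = {ps \<in> poly_prod kss. map fst ps = is \<and> ?Q (map snd ps)}"
    by (fastforce simp: table_set_def)
  then have comp: "map snd ` {ps \<in> table_set kss T. map fst ps = is} = {xs \<in> monomial ?ks. ?Q xs}"
    using component_eq[OF valid, of ?Q] by simp
  have "presburger_definable (count_list ?ks 0)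
      (free_part ?ks ` {xs \<in> {xs \<in> monomial ?ks. ?Q xs}. copy_index ?ks xs = c})" for c
  proof (cases "\<exists>xs\<in>monomial ?ks. copy_index ?ks xs = c")
    case True
    obtain p where p: "\<forall>e. holds e p \<longleftrightarrow>
        (\<exists>q\<in>set (map (\<lambda>(j, d, p). p) (filter (\<lambda>(j, d, p). j = is \<and> d = c) T)). holds e q)"
      using holds_finite_disj by blast
    have "{xs \<in> {xs \<in> monomial ?ks. ?Q xs}. copy_index ?ks xs = c} =
        {xs \<in> monomial ?ks. copy_index ?ks xs = c \<and> holds (tuple_env (free_part ?ks xs)) p}"
      by (fastforce simp: p)
    then show ?thesis
      using monomial_image[OF True, of "\<lambda>zs. holds (tuple_env zs) p"]
      unfolding presburger_definable_def by auto
  next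
    case False
    then have "{xs \<in> {xs \<in> monomial ?ks. ?Q xs}. copy_index ?ks xs = c} = {}" by auto
    then show ?thesis by (simp only: image_empty presburger_definable_empty)
  qed
  then show "semilinear_monomial ?ks (map snd ` {ps \<in> table_set kss T. map fst ps = is})"
    unfolding semilinear_monomial_def comp by auto
qed

lemma residues_rel_memberD:
  "c \<in> set (residues_rel z ks xs) \<Longrightarrow> \<exists>k x. (k, x) \<in> set (zip ks xs) \<and> k \<noteq> 0 \<and> c = (x - z) mod int k"
  by (auto simp: residues_rel_def)

lemma finite_copies:
  "finite ((\<lambda>ps. (map fst ps, copy_index (moduli kss (map fst ps)) (map snd ps))) ` poly_prod kss)"
proof -
  define N where "N = sum_list (map length kss)"
  define B where "B = sum_list (concat kss)"
  have "(map fst ps, copy_index (moduli kss (map fst ps)) (map snd ps)) \<in>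
      {is. set is \<subseteq> {..N} \<and> length is = length kss} \<times>
      {c. set c \<subseteq> {0..int B} \<and> length c \<le> length kss}" if "ps \<in> poly_prod kss" for ps
  proof -
    let ?is = "map fst ps" and ?xs = "map snd ps"
    have valid: "list_all2 (\<lambda>ks i. i < length ks) kss ?is" using that by (simp add: poly_prod_iff)
    have len: "length ?is = length kss" using list_all2_lengthD[OF valid] by simp
    have nth: "kss ! n \<in> set kss" "?is ! n < length (kss ! n)" if "n < length kss" for n
      using valid that by (auto simp: list_all2_conv_all_nth)
    have I: "i \<le> N" if i: "i \<in> set ?is" for i
    proof -
      obtain n where "n < length kss" "i = ?is ! n"
        using i len unfolding in_set_conv_nth by auto
      then have "i < length (kss ! n)" using nth(2)[of n] by simp
      also have "length (kss ! n) \<le> N"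
        unfolding N_def using nth(1)[OF \<open>n < length kss\<close>] by (intro member_le_sum_list) simp_all
      finally show ?thesis by simp
    qed
    have B: "k \<le> B" if k: "k \<in> set (moduli kss ?is)" for k
    proof -
      obtain n where "n < length kss" "k = kss ! n ! (?is ! n)"
        using k len unfolding in_set_conv_nth moduli_def by auto
      then have "k \<in> set (kss ! n)" using nth(2)[of n] by simp
      then have "k \<in> set (concat kss)"
        unfolding set_concat using nth(1)[OF \<open>n < length kss\<close>] by (rule UN_I[rotated])
      then show ?thesis unfolding B_def by (rule member_le_sum_list) simp
    qed
    have C: "c \<in> {0..int B}" if c: "c \<in> set (copy_index (moduli kss ?is) ?xs)" for c
    proof -
      obtain z k x where "(k, x) \<in> set (zip (moduli kss ?is) ?xs)" "k \<noteq> 0" "c = (x - z) mod int k"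
        using residues_rel_memberD[OF c[unfolded copy_index_alt]] by blast
      moreover from this have "k \<le> B" using B set_zip_leftD by metis
      moreover have "0 \<le> (x - z) mod int k" "(x - z) mod int k < int k" using \<open>k \<noteq> 0\<close> by simp_all
      ultimately show ?thesis by simp
    qed
    have "length (copy_index (moduli kss ?is) ?xs) \<le> length kss"
      unfolding copy_index_def Let_def length_map
      by (rule order_trans[OF length_filter_le]) (simp add: moduli_def)
    then show ?thesis using len I C by blast
  qed
  then have "(\<lambda>ps. (map fst ps, copy_index (moduli kss (map fst ps)) (map snd ps))) ` poly_prod kss \<subseteq>
      {is. set is \<subseteq> {..N} \<and> length is = length kss} \<times>
      {c. set c \<subseteq> {0..int B} \<and> length c \<le> length kss}"
    by (rule image_subsetI)
  moreover have "finite \<dots>"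
    by (intro finite_cartesian_product finite_lists_length_eq finite_lists_length_le) simp_all
  ultimately show ?thesis by (rule finite_subset)
qed

theorem semilinear_iff_table_set: "semilinear kss S \<longleftrightarrow> (\<exists>T. S = table_set kss T)"
proof
  assume sl: "semilinear kss S"
  then have S: "S \<subseteq> poly_prod kss" unfolding semilinear_def by (rule conjunct1)
  have "\<exists>p. \<forall>ps\<in>poly_prod kss. map fst ps = is \<longrightarrow> copy_index (moduli kss is) (map snd ps) = c \<longrightarrow>
      (ps \<in> S \<longleftrightarrow> holds (tuple_env (free_part (moduli kss is) (map snd ps))) p)" for "is" c
  proof (cases "list_all2 (\<lambda>ks i. i < length ks) kss is")
    case True
    let ?ks = "moduli kss is" and ?C = "map snd ` {ps \<in> S. map fst ps = is}"
    have sm: "semilinear_monomial ?ks ?C" 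
      using sl[unfolded semilinear_def, THEN conjunct2, rule_format, OF True] .
    have definable: "presburger_definable (count_list ?ks 0) (free_part ?ks ` {xs \<in> ?C. copy_index ?ks xs = c})"
    proof (cases "0 \<in> set ?ks")
      case True
      then show ?thesis by (rule sm[unfolded semilinear_monomial_def, THEN conjunct2, rule_format])
    next
      case False
      then have no_zero: "count_list ?ks 0 = 0" by simp
      define X where "X = free_part ?ks ` {xs \<in> ?C. copy_index ?ks xs = c}"
      have sub: "?C \<subseteq> monomial ?ks" using sm unfolding semilinear_monomial_def by (rule conjunct1)
      have "zs = []" if zs: "zs \<in> X" for zs
      proof -
        obtain xs where "xs \<in> ?C" "zs = free_part ?ks xs" using zs unfolding X_def by blast
        then show ?thesis using monomial_free_part_length[OF subsetD[OF sub]] no_zero by simp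
      qed
      then have "X = {} \<or> X = {[]}" by blast
      then have "presburger_definable 0 X"
      proof
        assume "X = {[]}"
        then show ?thesis unfolding presburger_definable_def
          by (intro exI[of _ "Eq (Const 0) (Const 0)"]) simp
      qed (simp add: presburger_definable_empty)
      then show ?thesis unfolding no_zero X_def .
    qed
    then obtain p where p: "free_part ?ks ` {xs \<in> ?C. copy_index ?ks xs = c} =
        {zs. length zs = count_list ?ks 0 \<and> holds (tuple_env zs) p}"
      unfolding presburger_definable_def by blast
    have "ps \<in> S \<longleftrightarrow> holds (tuple_env (free_part ?ks (map snd ps))) p"
      if ps: "ps \<in> poly_prod kss" "map fst ps = is" "copy_index ?ks (map snd ps) = c" for ps
    proof
      assume "ps \<in> S"
      then have "free_part ?ks (map snd ps) \<in> free_part ?ks ` {xs \<in> ?C. copy_index ?ks xs = c}"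
        using ps by blast
      then show "holds (tuple_env (free_part ?ks (map snd ps))) p" unfolding p by simp
    next
      have m: "map snd ps \<in> monomial ?ks" using ps by (simp add: poly_prod_iff)
      assume "holds (tuple_env (free_part ?ks (map snd ps))) p"
      then have "free_part ?ks (map snd ps) \<in> free_part ?ks ` {xs \<in> ?C. copy_index ?ks xs = c}"
        unfolding p using monomial_free_part_length[OF m] by blast
      then obtain ps' where ps': "ps' \<in> S" "map fst ps' = is" "copy_index ?ks (map snd ps') = c"
        "free_part ?ks (map snd ps) = free_part ?ks (map snd ps')" by auto
      moreover have "map snd ps' \<in> monomial ?ks" using ps' S by (auto simp: poly_prod_iff)
      ultimately have "map snd ps = map snd ps'" using monomial_inj[OF m] ps by metis
      then have "ps = ps'" using ps(2) ps'(2) by (metis zip_map_fst_snd)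
      then show "ps \<in> S" using ps' by simp
    qed
    then show ?thesis by blast
  next
    case False
    then show ?thesis by (auto simp: poly_prod_iff)
  qed
  then obtain p where p: "\<And>ps is c. ps \<in> poly_prod kss \<Longrightarrow> map fst ps = is \<Longrightarrow>
      copy_index (moduli kss is) (map snd ps) = c \<Longrightarrow>
      (ps \<in> S \<longleftrightarrow> holds (tuple_env (free_part (moduli kss is) (map snd ps))) (p is c))"
    by metis
  obtain L where L: "set L =
      (\<lambda>ps. (map fst ps, copy_index (moduli kss (map fst ps)) (map snd ps))) ` poly_prod kss"
    using finite_list[OF finite_copies] by blast
  have "S = table_set kss (map (\<lambda>(is, c). (is, c, p is c)) L)"
  proof (intro equalityI subsetI)
    fix ps assume "ps \<in> S"
    then show "ps \<in> table_set kss (map (\<lambda>(is, c). (is, c, p is c)) L)"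
      using S p[of ps, OF _ refl refl] by (force simp: table_set_def L)
  next
    fix ps assume "ps \<in> table_set kss (map (\<lambda>(is, c). (is, c, p is c)) L)"
    then show "ps \<in> S" by (auto simp: table_set_def p)
  qed
  then show "\<exists>T. S = table_set kss T" by blast
next
  assume "\<exists>T. S = table_set kss T"
  then show "semilinear kss S" using semilinear_table_set by auto
qed

end

theory Submission
  imports
    Defs
    "HOL-Library.Infinite_Set"
    "HOL-Computational_Algebra.Primes"
begin

text \<open>
  With a one-letter alphabet and the integers as states, a semilinear automaton iterates an arbitrary
  Presburger-definable function \<open>H\<close> on the integers, so emptiness asks whether the orbit of the
  initial state avoids an accepting state. Such iterations simulate register machines: the registers
  are the exponents of a product of prime powers, which \<open>H\<close> can multiply, divide and test for
  divisibility by a fixed prime, and the control state is kept in residues.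

  A universal machine is not needed for the diagonal argument. Given a decision procedure, build the
  automaton that reads a number \<open>x\<close> from its initial state, forms the code of the automaton with
  transition table \<open>x\<close> started on \<open>x\<close>, runs the decision procedure on that code, and accepts iff the
  answer is positive. Started on its own transition table it refutes the procedure. Since a decision
  procedure terminates on this instance, only terminating computations have to be simulated
  faithfully.
\<close>

section \<open>Presburger-definable functions\<close>

text \<open>Definability is kept semantic, so closure properties stand in for explicit
  formulas.\<close>

definition pdef :: "((nat \<Rightarrow> int) \<Rightarrow> bool) \<Rightarrow> bool" where
  "pdef P \<longleftrightarrow> (\<exists>p. \<forall>e. holds e p \<longleftrightarrow> P e)"

text \<open>The value is variable 0 and the arguments are shifted by one, as under
  \<open>Ex\<close>, so substituting a function costs a single quantifier.\<close>

definition fdef :: "((nat \<Rightarrow> int) \<Rightarrow> int) \<Rightarrow> bool" where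
  "fdef t \<longleftrightarrow> pdef (\<lambda>e. e 0 = t (\<lambda>n. e (Suc n)))"

lemma pdef_Not: "pdef P \<Longrightarrow> pdef (\<lambda>e. \<not> P e)"
  unfolding pdef_def by (metis holds.simps(3))

lemma pdef_conj: "pdef P \<Longrightarrow> pdef Q \<Longrightarrow> pdef (\<lambda>e. P e \<and> Q e)"
  unfolding pdef_def by (metis holds.simps(4))

lemma pdef_disj: "pdef P \<Longrightarrow> pdef Q \<Longrightarrow> pdef (\<lambda>e. P e \<or> Q e)"
  using pdef_Not[OF pdef_conj[OF pdef_Not pdef_Not], of P Q] by simp

lemma pdef_ex: "pdef P \<Longrightarrow> pdef (\<lambda>e. \<exists>x. P (case_nat x e))"
  unfolding pdef_def by (metis holds.simps(5))

lemma pdef_eq_term: "pdef (\<lambda>e. tval e s = tval e t)"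
  unfolding pdef_def by (metis holds.simps(1))

lemma pdef_less_term: "pdef (\<lambda>e. tval e s < tval e t)"
  unfolding pdef_def by (metis holds.simps(2))

section \<open>Renaming and substitution of variables\<close>

lemma tval_rename: "\<exists>u. \<forall>e. tval e u = tval (\<lambda>n. e (\<rho> n)) t"
proof (induction t)
  case (Const c) show ?case by (rule exI[of _ "Const c"]) simp
next
  case (Var n) show ?case by (rule exI[of _ "Var (\<rho> n)"]) simp
next
  case (Add s t) then show ?case by (metis tval.simps(3))
next
  case (Mul c t) then show ?case by (metis tval.simps(4))
qed

lemma holds_rename: "\<exists>q. \<forall>e. holds e q \<longleftrightarrow> holds (\<lambda>n. e (\<rho> n)) p"
proof (induction p arbitrary: \<rho>)
  case (Eq s t)
  show ?case using tval_rename[of \<rho> s] tval_rename[of \<rho> t] by (metis holds.simps(1))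
next
  case (Less s t)
  show ?case using tval_rename[of \<rho> s] tval_rename[of \<rho> t] by (metis holds.simps(2))
next
  case (Neg p) then show ?case by (metis holds.simps(3))
next
  case (Conj p q) then show ?case by (metis holds.simps(4))
next
  case (Ex p)
  \<comment> \<open>Under the binder, variable 0 stays fixed and the free variables are shifted;
    hence the induction over all renamings.\<close>
  obtain q where q: "\<forall>e. holds e q \<longleftrightarrow> holds (\<lambda>n. e (case_nat 0 (\<lambda>n. Suc (\<rho> n)) n)) p"
    using Ex.IH by blast
  have "(\<lambda>n. case_nat x e (case_nat 0 (\<lambda>n. Suc (\<rho> n)) n)) = case_nat x (\<lambda>n. e (\<rho> n))"
    for x and e :: "nat \<Rightarrow> int"
    by (auto simp: fun_eq_iff split: nat.split)
  then show ?case using q by (intro exI[of _ "Ex q"]) simp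
qed

lemma pdef_rename: "pdef P \<Longrightarrow> pdef (\<lambda>e. P (\<lambda>n. e (\<rho> n)))"
  unfolding pdef_def using holds_rename[of \<rho>] by metis

lemma pdef_subst:
  assumes "pdef P" "fdef t"
  shows "pdef (\<lambda>e. P (case_nat (t e) e))"
  using pdef_ex[OF pdef_conj[OF assms(2)[unfolded fdef_def] assms(1)]] by simp

lemma fdef_lift:
  assumes "fdef t"
  shows "fdef (\<lambda>e. t (\<lambda>n. e (Suc n)))"
  using pdef_rename[OF assms[unfolded fdef_def], of "case_nat 0 (\<lambda>n. Suc (Suc n))"]
  by (simp add: fdef_def)

lemma fdef_app2:
  assumes G: "pdef (\<lambda>e. e 0 = G (e (Suc 0)) (e (Suc (Suc 0))))" and "fdef t" "fdef s"
  shows "fdef (\<lambda>e. G (t e) (s e))"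
proof -
  \<comment> \<open>The result moves to index 2: each of the two substitutions eliminates variable
    0, so it ends at index 0.\<close>
  have "pdef (\<lambda>e. e (Suc (Suc 0)) = G (e 0) (e (Suc 0)))"
    using pdef_rename[OF G, of "\<lambda>n. if n = 0 then 2 else n - 1"] by (simp add: numeral_2_eq_2)
  from pdef_subst[OF this fdef_lift[OF fdef_lift[OF assms(2)]]]
  have "pdef (\<lambda>e. e (Suc 0) = G (t (\<lambda>n. e (Suc (Suc n)))) (e 0))" by simp
  from pdef_subst[OF this fdef_lift[OF assms(3)]] show ?thesis by (simp add: fdef_def)
qed

lemma fdef_app:
  assumes "fdef (\<lambda>e. F (e 0))" "fdef t"
  shows "fdef (\<lambda>e. F (t e))"
  using fdef_app2[of "\<lambda>x y. F x", OF _ assms(2) assms(2)] assms(1) by (simp add: fdef_def)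

section \<open>Linear terms, division, remainders and case distinction\<close>

lemma fdef_const: "fdef (\<lambda>e. c)"
  using pdef_eq_term[of "Var 0" "Const c"] by (simp add: fdef_def)

lemma fdef_var: "fdef (\<lambda>e. e n)"
  using pdef_eq_term[of "Var 0" "Var (Suc n)"] by (simp add: fdef_def)

lemma fdef_add: "fdef t \<Longrightarrow> fdef s \<Longrightarrow> fdef (\<lambda>e. t e + s e)"
  by (rule fdef_app2)
    (use pdef_eq_term[of "Var 0" "Add (Var (Suc 0)) (Var (Suc (Suc 0)))"] in simp)

lemma fdef_mult: "fdef t \<Longrightarrow> fdef (\<lambda>e. c * t e)"
  by (rule fdef_app[of "\<lambda>x. c * x"])
    (use pdef_eq_term[of "Var 0" "Mul c (Var (Suc 0))"] in \<open>simp_all add: fdef_def\<close>)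

text \<open>For a constant \<open>c\<close> the bounds \<open>c * y \<le> x < c * y + c\<close> are
  linear and determine the quotient.\<close>

lemma fdef_div:
  assumes "c > 0" "fdef t"
  shows "fdef (\<lambda>e. t e div c)"
proof (rule fdef_app[OF _ assms(2)])
  have "y = x div c \<longleftrightarrow> \<not> x < c * y \<and> x < c * y + c" for x y :: int
  proof
    assume "y = x div c"
    then have "x = c * y + x mod c" by simp
    moreover have "0 \<le> x mod c" "x mod c < c" using assms(1) by simp_all
    ultimately show "\<not> x < c * y \<and> x < c * y + c" by (intro conjI) linarith+
  next
    assume "\<not> x < c * y \<and> x < c * y + c"
    then have "(x - c * y) div c = 0" by (intro div_pos_pos_trivial) simp_all
    moreover have "(x - c * y + y * c) div c = y + (x - c * y) div c"
      using assms(1) by (intro div_mult_self1) simp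
    ultimately show "y = x div c" by (simp add: mult.commute)
  qed
  then show "fdef (\<lambda>e. e 0 div c)"
    unfolding fdef_def
    using pdef_conj[OF pdef_Not[OF pdef_less_term[of "Var (Suc 0)" "Mul c (Var 0)"]]
      pdef_less_term[of "Var (Suc 0)" "Add (Mul c (Var 0)) (Const c)"]]
    by simp
qed

lemma fdef_mod: "c > 0 \<Longrightarrow> fdef t \<Longrightarrow> fdef (\<lambda>e. t e mod c)"
  using fdef_add[OF _ fdef_mult[of "\<lambda>e. c * (t e div c)" "- 1"], of t]
    fdef_mult[OF fdef_div, of c t c]
  by (simp add: minus_mult_div_eq_mod)

lemma pdef_eq: "fdef t \<Longrightarrow> fdef s \<Longrightarrow> pdef (\<lambda>e. t e = s e)"
  using pdef_subst[of "\<lambda>e. e 0 = s (\<lambda>n. e (Suc n))" t] by (simp add: fdef_def)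

lemma fdef_if:
  assumes "pdef P" "fdef t" "fdef s"
  shows "fdef (\<lambda>e. if P e then t e else s e)"
proof -
  have P: "pdef (\<lambda>e. P (\<lambda>n. e (Suc n)))" using pdef_rename[OF assms(1)] .
  show ?thesis
    using pdef_disj[OF pdef_conj[OF P assms(2)[unfolded fdef_def]]
      pdef_conj[OF pdef_Not[OF P] assms(3)[unfolded fdef_def]]]
    unfolding fdef_def by (rule back_subst[of pdef]) auto
qed

lemmas fdef_intros =
  fdef_if pdef_eq fdef_mod fdef_div fdef_add fdef_mult fdef_var fdef_const

section \<open>Register programs\<close>

datatype prog = Skip | Inc nat | Dec nat | Seq prog prog | While nat prog

inductive exec :: "prog \<Rightarrow> (nat \<Rightarrow> nat) \<Rightarrow> (nat \<Rightarrow> nat) \<Rightarrow> bool" where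
  skip: "exec Skip s s"
| inc: "exec (Inc r) s (s(r := Suc (s r)))"
| dec: "exec (Dec r) s (s(r := s r - 1))"
| seq: "exec p s t \<Longrightarrow> exec q t u \<Longrightarrow> exec (Seq p q) s u"
| while_0: "s r = 0 \<Longrightarrow> exec (While r p) s s"
| while_Suc: "s r \<noteq> 0 \<Longrightarrow> exec p s t \<Longrightarrow> exec (While r p) t u \<Longrightarrow> exec (While r p) s u"

inductive_cases exec_elims:
  "exec Skip s t" "exec (Inc r) s t" "exec (Dec r) s t" "exec (Seq p q) s t" "exec (While r p) s t"

lemma exec_eq: "exec p s t \<Longrightarrow> t = t' \<Longrightarrow> exec p s t'"
  by simp

text \<open>Reduces a loop to an explicit sequence of stores; the induction runs backwards from the
  exit.\<close>

lemma exec_while_iterate: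
  assumes "\<And>i. i < n \<Longrightarrow> st i r \<noteq> 0 \<and> exec p (st i) (st (Suc i))" "st n r = 0" "i \<le> n"
  shows "exec (While r p) (st i) (st n)"
  using assms(3)
proof (induction rule: inc_induct)
  case base
  show ?case using assms(2) by (rule while_0)
next
  case (step i)
  then show ?case using assms(1)[of i] while_Suc by blast
qed

section \<open>Basic register operations\<close>

definition clear :: "nat \<Rightarrow> prog" where
  "clear r = While r (Dec r)"

definition move :: "nat \<Rightarrow> nat \<Rightarrow> prog" where
  "move a b = While a (Seq (Dec a) (Inc b))"

text \<open>Draining \<open>a\<close> destroys it, so each unit goes to both \<open>b\<close> and
  the scratch register \<open>d\<close>, from which \<open>a\<close> is refilled.\<close>

definition copy :: "nat \<Rightarrow> nat \<Rightarrow> nat \<Rightarrow> prog" where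
  "copy a b d = Seq (While a (Seq (Dec a) (Seq (Inc b) (Inc d)))) (move d a)"

lemma exec_clear: "exec (clear r) s (s(r := 0))"
proof -
  let ?st = "\<lambda>i. s(r := s r - i)"
  have "exec (Dec r) (?st i) (?st (Suc i))" for i
    by (rule exec_eq[OF dec]) simp
  then have "exec (While r (Dec r)) (?st 0) (?st (s r))"
    by (intro exec_while_iterate[where st = ?st]) simp_all
  then show ?thesis by (simp add: clear_def)
qed

lemma exec_move:
  assumes "a \<noteq> b"
  shows "exec (move a b) s (s(b := s b + s a, a := 0))"
proof -
  let ?st = "\<lambda>i. s(b := s b + i, a := s a - i)"
  have "exec (Seq (Dec a) (Inc b)) (?st i) (?st (Suc i))" for i
    by (rule exec_eq[OF seq[OF dec inc]]) (use assms in \<open>simp add: fun_eq_iff\<close>)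
  then have "exec (While a (Seq (Dec a) (Inc b))) (?st 0) (?st (s a))"
    by (intro exec_while_iterate[where st = ?st]) simp_all
  then show ?thesis by (simp add: move_def)
qed

lemma exec_copy:
  assumes "a \<noteq> b" "a \<noteq> d" "b \<noteq> d" "s d = 0" "s b = 0"
  shows "exec (copy a b d) s (s(b := s a))"
proof -
  let ?st = "\<lambda>i. s(b := i, d := i, a := s a - i)"
  have "exec (Seq (Dec a) (Seq (Inc b) (Inc d))) (?st i) (?st (Suc i))" for i
    by (rule exec_eq[OF seq[OF dec seq[OF inc inc]]]) (use assms in \<open>simp add: fun_eq_iff\<close>)
  then have "exec (While a (Seq (Dec a) (Seq (Inc b) (Inc d)))) (?st 0) (?st (s a))"
    by (intro exec_while_iterate[where st = ?st]) simp_all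
  then have 1: "exec (While a (Seq (Dec a) (Seq (Inc b) (Inc d)))) s (?st (s a))"
    using assms by (simp add: fun_upd_idem)
  show ?thesis unfolding copy_def
    by (rule exec_eq[OF seq[OF 1 exec_move]]) (use assms in \<open>auto simp: fun_eq_iff\<close>)
qed

section \<open>Compiling recursive functions\<close>

text \<open>
  Calling convention: the arguments are read from the registers \<open>as\<close>, the result is written to the
  register \<open>z\<close>, and the registers from \<open>d\<close> on are scratch space that is zero before and after.
\<close>

definition implements :: "prog \<Rightarrow> recf \<Rightarrow> nat list \<Rightarrow> nat \<Rightarrow> nat \<Rightarrow> bool" where
  "implements p f as z d \<longleftrightarrow>
     (\<forall>s y. rec_eval f (map s as) y \<longrightarrow> s z = 0 \<longrightarrow> (\<forall>r\<ge>d. s r = 0) \<longrightarrow> exec p s (s(z := y)))"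

lemma implementsD:
  "implements p f as z d \<Longrightarrow> rec_eval f (map s as) y \<Longrightarrow> s z = 0 \<Longrightarrow> (\<And>r. r \<ge> d \<Longrightarrow> s r = 0) \<Longrightarrow>
    exec p s (s(z := y))"
  by (simp add: implements_def)

lemma exec_clear_range: "\<exists>p. \<forall>s. exec p s (\<lambda>r. if d \<le> r \<and> r < d + m then 0 else s r)"
proof (induction m)
  case 0
  have "(\<lambda>r. if d \<le> r \<and> r < d + 0 then 0 else s r) = s" for s :: "nat \<Rightarrow> nat"
    by (simp add: fun_eq_iff)
  then show ?case by (intro exI[of _ Skip]) (simp add: skip)
next
  case (Suc m)
  then obtain p where p: "\<And>s. exec p s (\<lambda>r. if d \<le> r \<and> r < d + m then 0 else s r)" by blast
  have "exec (Seq p (clear (d + m))) s (\<lambda>r. if d \<le> r \<and> r < d + Suc m then 0 else s r)" for s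
    by (rule exec_eq[OF seq[OF p exec_clear]]) (auto simp: fun_eq_iff)
  then show ?case by blast
qed

definition store :: "nat \<Rightarrow> nat list \<Rightarrow> (nat \<Rightarrow> nat) \<Rightarrow> nat \<Rightarrow> nat" where
  "store d ys s r = (if d \<le> r \<and> r < d + length ys then ys ! (r - d) else s r)"

text \<open>Each result is stored above the arguments and the earlier results, and all calls share
  the scratch space from \<open>e\<close> on.\<close>

lemma implements_list:
  assumes "\<And>g j. g \<in> set gs \<Longrightarrow> j < e \<Longrightarrow> d \<le> j \<Longrightarrow> \<exists>p. implements p g as j e"
    "set as \<subseteq> {..<d}" "d + length gs \<le> e"
  shows "\<exists>p. \<forall>s ys. list_all2 (\<lambda>g y. rec_eval g (map s as) y) gs ys \<longrightarrow> (\<forall>r\<ge>d. s r = 0) \<longrightarrow>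
    exec p s (store d ys s)"
  using assms
proof (induction gs rule: rev_induct)
  case Nil
  have "store d [] s = s" for s by (simp add: fun_eq_iff store_def)
  then show ?case by (intro exI[of _ Skip]) (simp add: skip)
next
  case (snoc g gs)
  obtain p where p: "\<And>s ys. list_all2 (\<lambda>g y. rec_eval g (map s as) y) gs ys \<Longrightarrow> \<forall>r\<ge>d. s r = 0 \<Longrightarrow>
      exec p s (store d ys s)"
    using snoc.IH snoc.prems by auto
  obtain q where q: "implements q g as (d + length gs) e"
    using snoc.prems(1)[of g "d + length gs"] snoc.prems(3) by auto
  have "exec (Seq p q) s (store d ys s)"
    if ys: "list_all2 (\<lambda>g y. rec_eval g (map s as) y) (gs @ [g]) ys" and s: "\<forall>r\<ge>d. s r = 0" for s ys
  proof -
    obtain ys' y where ys': "ys = ys' @ [y]" "list_all2 (\<lambda>g y. rec_eval g (map s as) y) gs ys'"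
      "rec_eval g (map s as) y"
      using ys by (auto simp: list_all2_append1 list_all2_Cons1)
    have len: "length ys' = length gs" using list_all2_lengthD[OF ys'(2)] by simp
    have m: "map (store d ys' s) as = map s as"
      using snoc.prems(2) by (auto simp: store_def)
    have "exec q (store d ys' s) ((store d ys' s)(d + length gs := y))"
      by (rule implementsD[OF q]) (use ys'(3) s len snoc.prems(3) in \<open>auto simp: m store_def\<close>)
    then show ?thesis
      by (rule exec_eq[OF seq[OF p[OF ys'(2) s]]])
        (auto simp: fun_eq_iff store_def ys'(1) nth_append len)
  qed
  then show ?case by blast
qed

text \<open>Names the intermediate values, which give the stores at the head of the compiled
  loop.\<close>

lemma rec_eval_prim_sequence:
  "rec_eval (RPrim f g) (n # xs) y \<Longrightarrow>
    \<exists>Y. rec_eval f xs (Y 0) \<and> (\<forall>i<n. rec_eval g (i # Y i # xs) (Y (Suc i))) \<and> Y n = y"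
proof (induction n arbitrary: y)
  case 0
  then have "rec_eval f xs y" by (rule rec_eval_elims(5))
  then show ?case by (intro exI[of _ "\<lambda>_. y"]) simp
next
  case (Suc n)
  from Suc.prems obtain y' where y': "rec_eval (RPrim f g) (n # xs) y'" "rec_eval g (n # y' # xs) y"
    by (rule rec_eval_elims(6))
  from Suc.IH[OF y'(1)] obtain Y where "rec_eval f xs (Y 0)"
    "\<forall>i<n. rec_eval g (i # Y i # xs) (Y (Suc i))" "Y n = y'" by blast
  then show ?case using y'(2)
    by (intro exI[of _ "Y(Suc n := y)"]) (auto simp: less_Suc_eq)
qed

lemma rec_eval_mu_sequence:
  assumes "rec_eval (RMu f) xs n"
  shows "\<exists>Y. (\<forall>i\<le>n. rec_eval f (i # xs) (Y i)) \<and> (\<forall>i<n. Y i \<noteq> 0) \<and> Y n = 0"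
proof -
  from assms have n: "rec_eval f (n # xs) 0" "\<forall>m<n. \<exists>y. rec_eval f (m # xs) (Suc y)"
    by (rule rec_eval_elims(7), simp)+
  from n(2) obtain Y where "\<forall>m<n. rec_eval f (m # xs) (Suc (Y m))" by metis
  with n(1) show ?thesis
    by (intro exI[of _ "\<lambda>m. if m < n then Suc (Y m) else 0"]) (auto simp: le_less)
qed

text \<open>Compilation by structural induction, for all register choices because subprograms are
  called with other registers. Keeping \<open>z\<close> out of \<open>as\<close> protects the
  arguments from the result.\<close>

lemma ex_implements:
  "z < d \<Longrightarrow> set as \<subseteq> {..<d} \<Longrightarrow> z \<notin> set as \<Longrightarrow> \<exists>p. implements p f as z d"
proof (induction f arbitrary: as z d)
  case RZero
  have "implements Skip RZero as z d"
    unfolding implements_def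
  proof (intro allI impI)
    fix s :: "nat \<Rightarrow> nat" and y
    assume *: "rec_eval RZero (map s as) y" "s z = 0"
    from *(1) have "y = 0" by (rule rec_eval_elims(1))
    with *(2) have "s(z := y) = s" by (simp add: fun_upd_idem)
    then show "exec Skip s (s(z := y))" using skip by metis
  qed
  then show ?case by blast
next
  case RSucc
  have "implements (Seq (copy (as ! 0) z d) (Inc z)) RSucc as z d"
    unfolding implements_def
  proof (intro allI impI)
    fix s :: "nat \<Rightarrow> nat" and y
    assume *: "rec_eval RSucc (map s as) y" "s z = 0" "\<forall>r\<ge>d. s r = 0"
    from *(1) obtain x where "map s as = [x]" "y = Suc x" by (rule rec_eval_elims(2))
    then obtain a where a: "as = [a]" "y = Suc (s a)" by auto
    show "exec (Seq (copy (as ! 0) z d) (Inc z)) s (s(z := y))"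
      by (rule exec_eq[OF seq[OF exec_copy inc]]) (use RSucc *(2,3) a in auto)
  qed
  then show ?case by blast
next
  case (RProj i)
  have "implements (copy (as ! i) z d) (RProj i) as z d"
    unfolding implements_def
  proof (intro allI impI)
    fix s :: "nat \<Rightarrow> nat" and y
    assume *: "rec_eval (RProj i) (map s as) y" "s z = 0" "\<forall>r\<ge>d. s r = 0"
    from *(1) have i: "i < length as" "y = s (as ! i)"
      by (auto elim: rec_eval_elims(3))
    then have "as ! i \<in> set as" by simp
    then have "as ! i < d" "as ! i \<noteq> z" using RProj by auto
    then show "exec (copy (as ! i) z d) s (s(z := y))"
      using RProj *(2,3) i exec_copy[of "as ! i" z d s] by simp
  qed
  then show ?case by blast
next
  case (RComp f gs)
  define e where "e = d + length gs"
  have "\<exists>p. implements p g as j e" if "g \<in> set gs" "j < e" "d \<le> j" for g j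
    by (rule RComp.IH(2)) (use that RComp.prems in \<open>auto simp: e_def\<close>)
  from implements_list[OF this RComp.prems(2), of gs] obtain p where
    p: "\<And>s ys. list_all2 (\<lambda>g y. rec_eval g (map s as) y) gs ys \<Longrightarrow> \<forall>r\<ge>d. s r = 0 \<Longrightarrow>
      exec p s (store d ys s)"
    by (auto simp: e_def)
  obtain q where q: "implements q f [d..<e] z e"
    using RComp.IH(1)[of z e "[d..<e]"] RComp.prems(1) by (fastforce simp: e_def)
  obtain c where c: "\<And>s. exec c s (\<lambda>r. if d \<le> r \<and> r < d + length gs then 0 else s r)"
    using exec_clear_range by blast
  have "implements (Seq p (Seq q c)) (RComp f gs) as z d"
    unfolding implements_def
  proof (intro allI impI)
    fix s :: "nat \<Rightarrow> nat" and y
    assume *: "rec_eval (RComp f gs) (map s as) y" "s z = 0" "\<forall>r\<ge>d. s r = 0"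
    from *(1) obtain ys where ys: "list_all2 (\<lambda>g y. rec_eval g (map s as) y) gs ys" "rec_eval f ys y"
      by (rule rec_eval_elims(4))
    have len: "length ys = length gs" using list_all2_lengthD[OF ys(1)] by simp
    have m: "map (store d ys s) [d..<e] = ys"
      by (rule nth_equalityI) (auto simp: e_def len store_def)
    have 2: "exec q (store d ys s) ((store d ys s)(z := y))"
      by (rule implementsD[OF q]) (use ys(2) m * RComp.prems len in \<open>auto simp: store_def e_def\<close>)
    show "exec (Seq p (Seq q c)) s (s(z := y))"
      by (rule exec_eq[OF seq[OF p[OF ys(1) *(3)] seq[OF 2 c]]])
        (use * RComp.prems len in \<open>auto simp: fun_eq_iff store_def\<close>)
  qed
  then show ?case by blast
next
  case (RPrim f g)
  show ?case
  proof (cases as)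
    case Nil
    \<comment> \<open>Primitive recursion on an empty argument list is undefined, so any program
      will do.\<close>
    have "implements Skip (RPrim f g) as z d"
      unfolding implements_def Nil by (auto elim: rec_eval.cases)
    then show ?thesis by blast
  next
    case (Cons a bs)
    \<comment> \<open>Register \<open>d\<close> counts the remaining rounds, \<open>d + 1\<close>
      the completed ones; \<open>d + 2\<close> holds the current value and \<open>d + 3\<close> the
      next.\<close>
    obtain p where p: "implements p f bs (d + 2) (d + 4)"
      using RPrim.IH(1)[of "d + 2" "d + 4" bs] RPrim.prems Cons by fastforce
    obtain q where q: "implements q g ((d + 1) # (d + 2) # bs) (d + 3) (d + 4)"
      using RPrim.IH(2)[of "d + 3" "d + 4" "(d + 1) # (d + 2) # bs"] RPrim.prems Cons by fastforce
    define body where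
      "body = Seq (Dec d) (Seq q (Seq (clear (d + 2)) (Seq (move (d + 3) (d + 2)) (Inc (d + 1)))))"
    define r where "r = Seq (copy a d (d + 1)) (Seq p (Seq (While d body)
      (Seq (clear (d + 1)) (move (d + 2) z))))"
    have "implements r (RPrim f g) as z d"
      unfolding implements_def
    proof (intro allI impI)
      fix s :: "nat \<Rightarrow> nat" and y
      assume *: "rec_eval (RPrim f g) (map s as) y" "s z = 0" "\<forall>r\<ge>d. s r = 0"
      define n where "n = s a"
      from *(1) obtain Y where Y: "rec_eval f (map s bs) (Y 0)"
        "\<And>i. i < n \<Longrightarrow> rec_eval g (i # Y i # map s bs) (Y (Suc i))" "Y n = y"
        using rec_eval_prim_sequence unfolding Cons n_def list.map by metis
      have below: "b < d" if "b \<in> set bs" for b using that RPrim.prems Cons by auto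
      have a: "a < d" "a \<noteq> z" using RPrim.prems Cons by auto
      define st where "st i = s(d := n - i, d + 1 := i, d + 2 := Y i)" for i
      have 1: "exec (copy a d (d + 1)) s (s(d := n))"
        unfolding n_def by (rule exec_copy) (use * a in auto)
      have "map (s(d := n)) bs = map s bs" using below by auto
      then have "rec_eval f (map (s(d := n)) bs) (Y 0)" using Y(1) by (simp only:)
      then have "exec p (s(d := n)) ((s(d := n))(d + 2 := Y 0))"
        by (rule implementsD[OF p]) (use * in auto)
      then have 2: "exec p (s(d := n)) (st 0)"
        by (rule exec_eq) (use * in \<open>auto simp: st_def fun_eq_iff\<close>)
      have "exec body (st i) (st (Suc i))" if i: "i < n" for i
      proof -
        let ?t = "(st i)(d := st i d - 1)"
        have "map ?t ((d + 1) # (d + 2) # bs) = i # Y i # map s bs"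
          by (auto simp: st_def dest!: below)
        then have "rec_eval g (map ?t ((d + 1) # (d + 2) # bs)) (Y (Suc i))"
          using Y(2)[OF i] by (simp only:)
        then have "exec q ?t (?t(d + 3 := Y (Suc i)))"
          by (rule implementsD[OF q]) (use * in \<open>auto simp: st_def\<close>)
        then show ?thesis unfolding body_def
          by (intro exec_eq[OF seq[OF dec seq[OF _ seq[OF exec_clear seq[OF exec_move inc]]]]])
            (use * in \<open>auto simp: st_def fun_eq_iff\<close>)
      qed
      then have 3: "exec (While d body) (st 0) (st n)"
        by (intro exec_while_iterate[where st = st]) (auto simp: st_def)
      show "exec r s (s(z := y))" unfolding r_def
        by (rule exec_eq[OF seq[OF 1 seq[OF 2 seq[OF 3 seq[OF exec_clear exec_move]]]]])
          (use * RPrim.prems Y(3) in \<open>auto simp: st_def fun_eq_iff\<close>)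
    qed
    then show ?thesis by blast
  qed
next
  case (RMu f)
  obtain p where p: "implements p f (d # as) (d + 1) (d + 2)"
    using RMu.IH[of "d + 1" "d + 2" "d # as"] RMu.prems by fastforce
  \<comment> \<open>Register \<open>d\<close> holds the candidate and \<open>d + 1\<close> the value
    of \<open>f\<close> there, on which the loop is controlled.\<close>
  define body where "body = Seq (clear (d + 1)) (Seq (Inc d) p)"
  have "implements (Seq p (Seq (While (d + 1) body) (move d z))) (RMu f) as z d"
    unfolding implements_def
  proof (intro allI impI)
    fix s :: "nat \<Rightarrow> nat" and n
    assume *: "rec_eval (RMu f) (map s as) n" "s z = 0" "\<forall>r\<ge>d. s r = 0"
    from rec_eval_mu_sequence[OF *(1)] obtain Y where
      Y: "\<And>i. i \<le> n \<Longrightarrow> rec_eval f (i # map s as) (Y i)" "\<And>i. i < n \<Longrightarrow> Y i \<noteq> 0" "Y n = 0"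
      by blast
    have below: "b < d" if "b \<in> set as" for b using that RMu.prems by auto
    define st where "st i = s(d := i, d + 1 := Y i)" for i
    have p': "exec p (s(d := i)) (st i)" if "i \<le> n" for i
    proof -
      have "map (s(d := i)) (d # as) = i # map s as" using below by auto
      then have "rec_eval f (map (s(d := i)) (d # as)) (Y i)"
        using Y(1)[OF that] by (simp only:)
      then have "exec p (s(d := i)) ((s(d := i))(d + 1 := Y i))"
        by (rule implementsD[OF p]) (use * in auto)
      then show ?thesis by (simp add: st_def)
    qed
    have "s(d := 0) = s" using * by (simp add: fun_upd_idem)
    then have 1: "exec p s (st 0)" using p'[of 0] by simp
    have "exec body (st i) (st (Suc i))" if i: "i < n" for i
    proof -
      have "(st i)(d + 1 := 0, d := Suc (((st i)(d + 1 := 0)) d)) = s(d := Suc i)"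
        using * by (auto simp: st_def fun_eq_iff)
      then show ?thesis unfolding body_def
        using seq[OF exec_clear seq[OF inc]] p'[of "Suc i"] i by (metis Suc_leI)
    qed
    then have 2: "exec (While (d + 1) body) (st 0) (st n)"
      by (intro exec_while_iterate[where st = st]) (use Y(2,3) in \<open>auto simp: st_def\<close>)
    show "exec (Seq p (Seq (While (d + 1) body) (move d z))) s (s(z := n))"
      by (rule exec_eq[OF seq[OF 1 seq[OF 2 exec_move]]])
        (use * RMu.prems Y(3) in \<open>auto simp: st_def fun_eq_iff\<close>)
  qed
  then show ?case by blast
qed

section \<open>Simulating programs by iterating a Presburger-definable function\<close>

primrec regs :: "prog \<Rightarrow> nat set" where
  "regs Skip = {}"
| "regs (Inc r) = {r}"
| "regs (Dec r) = {r}"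
| "regs (Seq p q) = regs p \<union> regs q"
| "regs (While r p) = insert r (regs p)"

lemma finite_regs: "finite (regs p)"
  by (induction p) simp_all

section \<open>Goedel numbers of register contents\<close>

definition reg_prime :: "nat \<Rightarrow> nat" where
  "reg_prime r = enumerate {p. prime p} r"

lemma prime_reg_prime: "prime (reg_prime r)"
  using enumerate_in_set[OF primes_infinite] by (simp add: reg_prime_def)

lemma reg_prime_eq_iff: "reg_prime q = reg_prime r \<longleftrightarrow> q = r"
  using strict_mono_enumerate[OF primes_infinite] by (simp add: reg_prime_def strict_mono_eq)

lemma reg_prime_pos: "reg_prime r > 0"
  using prime_reg_prime by (rule prime_gt_0_nat)

text \<open>Stores are total functions, so the product is meant over a finite set \<open>A\<close>
  of relevant registers.\<close>

definition godel :: "nat set \<Rightarrow> (nat \<Rightarrow> nat) \<Rightarrow> nat" where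
  "godel A s = (\<Prod>r\<in>A. reg_prime r ^ s r)"

lemma godel_upd:
  assumes "finite A" "r \<in> A"
  shows "godel A (s(r := n)) = reg_prime r ^ n * (\<Prod>q\<in>A - {r}. reg_prime q ^ s q)"
  unfolding godel_def by (subst prod.remove[OF assms]) simp

text \<open>Incrementing a register becomes multiplication by a constant, which Presburger
  arithmetic can express.\<close>

lemma godel_Suc:
  assumes "finite A" "r \<in> A"
  shows "godel A (s(r := Suc n)) = reg_prime r * godel A (s(r := n))"
  using assms by (simp add: godel_upd)

text \<open>A prime dividing the product divides some factor, and distinct registers have distinct
  primes. The zero test thus becomes a divisibility test.\<close>

lemma reg_prime_dvd_godel:
  assumes "finite A" "r \<in> A"
  shows "reg_prime r dvd godel A s \<longleftrightarrow> s r \<noteq> 0"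
proof -
  have "reg_prime r dvd godel A s \<longleftrightarrow> (\<exists>q\<in>A. reg_prime r dvd reg_prime q ^ s q)"
    unfolding godel_def by (rule prime_dvd_prod_iff[OF assms(1) prime_reg_prime])
  also have "\<dots> \<longleftrightarrow> (\<exists>q\<in>A. q = r \<and> s q \<noteq> 0)"
    using primes_dvd_imp_eq[OF prime_reg_prime prime_reg_prime] prime_dvd_power[OF prime_reg_prime]
    by (metis dvd_power gr0I nat_dvd_1_iff_1 not_prime_1 power_0 prime_reg_prime reg_prime_eq_iff)
  also have "\<dots> \<longleftrightarrow> s r \<noteq> 0" using assms(2) by blast
  finally show ?thesis .
qed

lemma godel_mod_eq_0:
  "finite A \<Longrightarrow> r \<in> A \<Longrightarrow> int (godel A s) mod int (reg_prime r) = 0 \<longleftrightarrow> s r \<noteq> 0"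
  using reg_prime_dvd_godel[of A r s] by (simp flip: zmod_int dvd_eq_mod_eq_0)

text \<open>
  A function \<open>F\<close> simulating a program has entry states \<open>3 v\<close> and exit states \<open>3 v + 1\<close>, where \<open>v\<close> is the
  Goedel number of the registers; the states \<open>3 v + 2\<close> are internal.
\<close>

definition moves :: "(int \<Rightarrow> int) \<Rightarrow> int \<Rightarrow> int \<Rightarrow> bool" where
  "moves F x y \<longleftrightarrow> x mod 3 \<noteq> 1 \<and> y = F x"

text \<open>Since \<open>moves F\<close> is deterministic and stops at exit states, reaching one
  fixes the outcome. The common set \<open>A\<close> lets simulations be chained.\<close>

definition simulates :: "nat set \<Rightarrow> (int \<Rightarrow> int) \<Rightarrow> prog \<Rightarrow> bool" where
  "simulates A F p \<longleftrightarrow>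
     (\<forall>s t. exec p s t \<longrightarrow> (moves F)\<^sup>*\<^sup>* (3 * int (godel A s)) (3 * int (godel A t) + 1))"

section \<open>Embedding machines into larger ones\<close>

lemma rtranclp_map:
  assumes "\<And>x y. R x y \<Longrightarrow> S (h x) (h y)" "R\<^sup>*\<^sup>* x y"
  shows "S\<^sup>*\<^sup>* (h x) (h y)"
  using assms(2) by induction (auto intro: assms(1) rtranclp.rtrancl_into_rtrancl)

text \<open>State \<open>x\<close> of \<open>F\<close> is embedded as \<open>6 * x + 2\<close> and
  state \<open>x\<close> of \<open>G\<close> as \<open>6 * x + 5\<close>; both are internal, being 2
  modulo 3. An exit of \<open>F\<close> is handed to the matching entry of \<open>G\<close>.\<close>

definition seq_fun :: "(int \<Rightarrow> int) \<Rightarrow> (int \<Rightarrow> int) \<Rightarrow> int \<Rightarrow> int" where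
  "seq_fun F G x =
     (if x mod 3 = 0 then 6 * x + 2
      else if x mod 6 = 2 then
        (if (x div 6) mod 3 = 1 then 6 * (3 * ((x div 6) div 3)) + 5 else 6 * F (x div 6) + 2)
      else
        (if (x div 6) mod 3 = 1 then 3 * ((x div 6) div 3) + 1 else 6 * G (x div 6) + 5))"

text \<open>The entry state is the loop head, with divisibility by \<open>c\<close> as the loop
  test. State \<open>x\<close> of the body is embedded as \<open>3 * x + 2\<close>.\<close>

definition while_fun :: "int \<Rightarrow> (int \<Rightarrow> int) \<Rightarrow> int \<Rightarrow> int" where
  "while_fun c F x =
     (if x mod 3 = 0 then (if (x div 3) mod c = 0 then 3 * x + 2 else x + 1)
      else if (x div 3) mod 3 = 1 then 3 * ((x div 3) div 3) else 3 * F (x div 3) + 2)"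

lemma fdef_seq_fun:
  assumes "fdef (\<lambda>e. F (e 0))" "fdef (\<lambda>e. G (e 0))"
  shows "fdef (\<lambda>e. seq_fun F G (e 0))"
  unfolding seq_fun_def
  by (intro fdef_intros fdef_app[of F, OF assms(1)] fdef_app[of G, OF assms(2)]) simp_all

lemma fdef_while_fun:
  assumes "c > 0" "fdef (\<lambda>e. F (e 0))"
  shows "fdef (\<lambda>e. while_fun c F (e 0))"
  unfolding while_fun_def
  by (intro fdef_intros fdef_app[of F, OF assms(2)]) (use assms(1) in simp_all)

lemma simulates_seq:
  assumes "simulates A F p" "simulates A G q"
  shows "simulates A (seq_fun F G) (Seq p q)"
  unfolding simulates_def
proof (intro allI impI)
  let ?H = "seq_fun F G"
  fix s u assume "exec (Seq p q) s u"
  then obtain t where t: "exec p s t" "exec q t u" by (rule exec_elims(4))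
  let ?a = "int (godel A s)" and ?b = "int (godel A t)" and ?c = "int (godel A u)"
  have five: "(6 * x + 5) mod 6 = 5" "(6 * x + 5) div 6 = x" "(6 * x + 5) mod 3 = 2"
    and two: "(6 * x + 2) mod 6 = 2" "(6 * x + 2) div 6 = x" "(6 * x + 2) mod 3 = 2" for x :: int
    by presburger+
  have "(moves ?H)\<^sup>*\<^sup>* (3 * ?a) (6 * (3 * ?a) + 2)"
    by (rule r_into_rtranclp) (simp add: moves_def seq_fun_def)
  \<comment> \<open>A move of \<open>F\<close> from \<open>x\<close> requires
    \<open>x mod 3 \<noteq> 1\<close>, which selects the branch of \<open>seq_fun\<close> that
    applies \<open>F\<close>.\<close>
  also have "(moves ?H)\<^sup>*\<^sup>* (6 * (3 * ?a) + 2) (6 * (3 * ?b + 1) + 2)"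
    using assms(1) t(1)
    by (intro rtranclp_map[where R = "moves F" and h = "\<lambda>x. 6 * x + 2"])
      (simp_all only: moves_def seq_fun_def two simulates_def, simp)
  also (rtranclp_trans) have "(moves ?H)\<^sup>*\<^sup>* (6 * (3 * ?b + 1) + 2) (6 * (3 * ?b) + 5)"
    by (rule r_into_rtranclp) (unfold moves_def seq_fun_def two, simp)
  also (rtranclp_trans) have "(moves ?H)\<^sup>*\<^sup>* (6 * (3 * ?b) + 5) (6 * (3 * ?c + 1) + 5)"
    using assms(2) t(2)
    by (intro rtranclp_map[where R = "moves G" and h = "\<lambda>x. 6 * x + 5"])
      (simp_all only: moves_def seq_fun_def five simulates_def, simp)
  also (rtranclp_trans) have "(moves ?H)\<^sup>*\<^sup>* (6 * (3 * ?c + 1) + 5) (3 * ?c + 1)"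
    by (rule r_into_rtranclp) (unfold moves_def seq_fun_def five, simp)
  finally (rtranclp_trans) show "(moves ?H)\<^sup>*\<^sup>* (3 * ?a) (3 * ?c + 1)" .
qed

lemma simulates_while:
  assumes "finite A" "r \<in> A" "simulates A F p"
  shows "simulates A (while_fun (int (reg_prime r)) F) (While r p)"
  unfolding simulates_def
proof (intro allI impI)
  let ?H = "while_fun (int (reg_prime r)) F"
  fix s u assume "exec (While r p) s u"
  then show "(moves ?H)\<^sup>*\<^sup>* (3 * int (godel A s)) (3 * int (godel A u) + 1)"
  proof (induction "While r p" s u)
    case (while_0 s)
    then have "moves ?H (3 * int (godel A s)) (3 * int (godel A s) + 1)"
      using godel_mod_eq_0[OF assms(1,2), of s] by (simp add: moves_def while_fun_def)
    then show ?case by blast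
  next
    case (while_Suc s t u)
    let ?a = "int (godel A s)" and ?b = "int (godel A t)"
    have two: "(3 * x + 2) div 3 = x" "(3 * x + 2) mod 3 = 2" for x :: int by presburger+
    have "(moves ?H)\<^sup>*\<^sup>* (3 * ?a) (3 * (3 * ?a) + 2)"
      using godel_mod_eq_0[OF assms(1,2), of s] while_Suc
      by (intro r_into_rtranclp) (simp add: moves_def while_fun_def)
    also have "(moves ?H)\<^sup>*\<^sup>* (3 * (3 * ?a) + 2) (3 * (3 * ?b + 1) + 2)"
      using assms(3) while_Suc(2)
      by (intro rtranclp_map[where R = "moves F" and h = "\<lambda>x. 3 * x + 2"])
        (simp_all only: moves_def while_fun_def two simulates_def, simp)
    \<comment> \<open>The exit of the body leads back to the loop head, where the induction
      hypothesis takes over.\<close>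
    also (rtranclp_trans) have "(moves ?H)\<^sup>*\<^sup>* (3 * (3 * ?b + 1) + 2) (3 * ?b)"
      by (rule r_into_rtranclp) (unfold moves_def while_fun_def two, simp)
    also (rtranclp_trans) note while_Suc(5)
    finally (rtranclp_trans) show ?case .
  qed
qed

lemma ex_simulates:
  "finite A \<Longrightarrow> regs p \<subseteq> A \<Longrightarrow> \<exists>F. fdef (\<lambda>e. F (e 0)) \<and> simulates A F p"
proof (induction p)
  case Skip
  define F where "F x = x + 1" for x :: int
  have "simulates A F Skip"
    by (auto simp: simulates_def moves_def F_def elim!: exec_elims(1) intro!: r_into_rtranclp)
  moreover have "fdef (\<lambda>e. F (e 0))" unfolding F_def by (intro fdef_intros)
  ultimately show ?case by blast
next
  case (Inc r)
  \<comment> \<open>An entry \<open>3 * v\<close> goes straight to \<open>3 * (c * v) + 1\<close>,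
    where \<open>c\<close> is the prime of \<open>r\<close>.\<close>
  define F where "F x = int (reg_prime r) * x + 1" for x :: int
  have "simulates A F (Inc r)"
    using Inc godel_Suc[of A r]
    by (auto simp: simulates_def moves_def F_def elim!: exec_elims(2) intro!: r_into_rtranclp)
  moreover have "fdef (\<lambda>e. F (e 0))" unfolding F_def by (intro fdef_intros)
  ultimately show ?case by blast
next
  case (Dec r)
  let ?c = "int (reg_prime r)"
  \<comment> \<open>If the prime does not divide, the register is zero and truncated subtraction
    leaves the store unchanged.\<close>
  define F where "F x = (if (x div 3) mod ?c = 0 then 3 * ((x div 3) div ?c) + 1 else x + 1)"
    for x :: int
  have c: "?c > 0" using reg_prime_pos by simp
  have "simulates A F (Dec r)"
    unfolding simulates_def
  proof (intro allI impI)
    fix s t assume "exec (Dec r) s t"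
    then have t: "t = s(r := s r - 1)" by (auto elim: exec_elims(3))
    have A: "finite A" "r \<in> A" using Dec by auto
    have "F (3 * int (godel A s)) = 3 * int (godel A t) + 1"
    proof (cases "s r")
      case 0
      then have "t = s" by (simp add: t fun_upd_idem)
      then show ?thesis using godel_mod_eq_0[OF A, of s] 0 by (simp add: F_def)
    next
      case (Suc n)
      then have "s(r := Suc n) = s" by (simp add: fun_upd_idem)
      then have "godel A s = reg_prime r * godel A t" using godel_Suc[OF A, of s n] t Suc by simp
      then show ?thesis using c by (simp add: F_def)
    qed
    then show "(moves F)\<^sup>*\<^sup>* (3 * int (godel A s)) (3 * int (godel A t) + 1)"
      by (intro r_into_rtranclp) (simp add: moves_def)
  qed
  moreover have "fdef (\<lambda>e. F (e 0))" unfolding F_def by (intro fdef_intros) (use c in simp_all)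
  ultimately show ?case by blast
next
  case (Seq p q)
  then obtain F G where "fdef (\<lambda>e. F (e 0))" "simulates A F p" "fdef (\<lambda>e. G (e 0))" "simulates A G q"
    by auto
  then show ?case using fdef_seq_fun simulates_seq by blast
next
  case (While r p)
  then obtain F where "fdef (\<lambda>e. F (e 0))" "simulates A F p" by auto
  moreover have "r \<in> A" using While by simp
  ultimately show ?case
    using fdef_while_fun[of "int (reg_prime r)" F] simulates_while[of A r F p] While.prems(1) reg_prime_pos
    by auto
qed

section \<open>The automaton that iterates a function\<close>

definition zero_table :: table where
  "zero_table = [([0], [], Eq (Var 0) (Const 0))]"

text \<open>Modulus 0 gives the integers as states, modulus 1 a single letter, whose only residue is
  0. Variables 0 and 1 of \<open>p\<close> are source and target.\<close>

definition iter_code :: "pform \<Rightarrow> int \<Rightarrow> dfa_code" where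
  "iter_code p v = DFA_Code [0] [1] [([0, 0, 0], [0], p)] (0, v) zero_table"

lemma trans_graph_iter_code:
  assumes "\<And>e. holds e p \<longleftrightarrow> e (Suc 0) = H (e 0)"
  shows "trans_graph (dfa_of (iter_code p v)) = {((0, x), (0, 0), (0, H x)) | x. True}"
proof -
  have "[q, a, r] \<in> table_set [[0], [1], [0]] [([0, 0, 0], [0], p)] \<longleftrightarrow>
      (\<exists>x. q = (0, x) \<and> a = (0, 0) \<and> r = (0, H x))" for q a r
    by (cases q; cases a; cases r)
      (auto simp: table_set_def poly_prod_def elems_orbit_sum Zmod_def moduli_def copy_index_def
        free_part_def assms tuple_env_def)
  then show ?thesis by (auto simp: dfa_of_def iter_code_def)
qed

lemma accepting_iter_code: "accepting (dfa_of (iter_code p v)) = {(0, 0)}"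
proof -
  have "[q] \<in> table_set [[0]] zero_table \<longleftrightarrow> q = (0, 0)" for q
    by (cases q)
      (auto simp: table_set_def poly_prod_def elems_orbit_sum Zmod_def moduli_def copy_index_def
        free_part_def tuple_env_def zero_table_def)
  then show ?thesis by (auto simp: dfa_of_def iter_code_def)
qed

lemma iter_code_simps:
  "elems (states (dfa_of (iter_code p v))) = {(0, x) | x. True}"
  "elems (alphabet (dfa_of (iter_code p v))) = {(0, 0)}"
  "init (dfa_of (iter_code p v)) = (0, v)"
  by (auto simp: dfa_of_def iter_code_def elems_orbit_sum Zmod_def)

lemma semilinear_dfa_iter_code:
  assumes "\<And>e. holds e p \<longleftrightarrow> e (Suc 0) = H (e 0)"
  shows "semilinear_dfa (dfa_of (iter_code p v))"
proof -
  let ?M = "dfa_of (iter_code p v)"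
  have orbits: "states ?M = orbit_sum [0]" "alphabet ?M = orbit_sum [1]"
    by (simp_all add: dfa_of_def iter_code_def)
  have "is_dfa ?M"
    unfolding is_dfa_def iter_code_simps accepting_iter_code trans_graph_iter_code[of p H, OF assms]
    using orbit_finite_orbit_sum orbits by auto
  moreover have "equivariant_iso id X X" for X :: "(nat \<times> int) atom_set"
    by (simp add: equivariant_iso_def)
  moreover have "(\<lambda>(q, a, r). [id q, id a, id r]) ` trans_graph ?M =
      table_set [[0], [1], [0]] [([0, 0, 0], [0], p)]"
  proof -
    have "\<exists>q a r. ps = [q, a, r]" if "ps \<in> table_set [[0], [1], [0]] T" for ps T
      using that by (auto simp: table_set_def poly_prod_def list_all2_Cons1)
    then show ?thesis by (force simp: dfa_of_def iter_code_def)
  qed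
  ultimately show ?thesis
    unfolding semilinear_dfa_def orbits by (metis semilinear_table_set)
qed

text \<open>Over one letter a word is determined by its length, and each letter applies
  \<open>H\<close> once.\<close>

lemma language_iter_code:
  assumes "\<And>e. holds e p \<longleftrightarrow> e (Suc 0) = H (e 0)"
  shows "language (dfa_of (iter_code p v)) \<noteq> {} \<longleftrightarrow> (\<exists>n. (H ^^ n) v = 0)"
proof -
  let ?M = "dfa_of (iter_code p v)"
  have step: "step ?M (0, x) (0, 0) = (0, H x)" for x
    unfolding step_def trans_graph_iter_code[of p H, OF assms] by auto
  have run: "foldl (step ?M) (0, x) (replicate n (0, 0)) = (0, (H ^^ n) x)" for n x
    by (induction n arbitrary: x) (simp_all add: step funpow_swap1)
  have "w \<in> lists {(0, 0)} \<longleftrightarrow> (\<exists>n. w = replicate n (0, 0))" for w :: "(nat \<times> int) list"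
    by (induction w) (auto simp: Cons_replicate_eq)
  then show ?thesis
    by (auto simp: language_def iter_code_simps accepting_iter_code run)
qed

section \<open>Computing the code of the automaton\<close>

definition computable :: "(nat \<Rightarrow> nat) \<Rightarrow> bool" where
  "computable F \<longleftrightarrow> (\<exists>f. \<forall>x. rec_eval f [x] (F x))"

lemma rec_eval_comp1: "rec_eval g xs y \<Longrightarrow> rec_eval f [y] z \<Longrightarrow> rec_eval (RComp f [g]) xs z"
  by (rule comp[where ys = "[y]"]) simp_all

lemma rec_eval_comp2:
  "rec_eval g xs y \<Longrightarrow> rec_eval h xs y' \<Longrightarrow> rec_eval f [y, y'] z \<Longrightarrow> rec_eval (RComp f [g, h]) xs z"
  by (rule comp[where ys = "[y, y']"]) simp_all

lemma rec_eval_proj: "i < length xs \<Longrightarrow> xs ! i = y \<Longrightarrow> rec_eval (RProj i) xs y"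
  using proj by blast

lemma rec_eval_const: "\<exists>f. \<forall>xs. rec_eval f xs c"
proof (induction c)
  case 0 show ?case using zero by blast
next
  case (Suc c) then show ?case using rec_eval_comp1 succ by metis
qed

lemma computable_const: "computable (\<lambda>x. c)"
  unfolding computable_def using rec_eval_const by metis

lemma computable_id: "computable (\<lambda>x. x)"
  unfolding computable_def by (rule exI[of _ "RProj 0"]) (simp add: rec_eval_proj)

lemma computable_comp: "computable F \<Longrightarrow> computable G \<Longrightarrow> computable (\<lambda>x. F (G x))"
  unfolding computable_def using rec_eval_comp1 by metis

lemma computable_Suc: "computable G \<Longrightarrow> computable (\<lambda>x. Suc (G x))"
  unfolding computable_def using rec_eval_comp1 succ by metis

section \<open>Arithmetic and pairing\<close>

lemma rec_eval_add: "rec_eval (RPrim (RProj 0) (RComp RSucc [RProj 1])) [m, n] (m + n)"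
proof (induction m)
  case 0 show ?case by (auto intro!: prim_0 rec_eval_proj)
next
  case (Suc m)
  then show ?case by (auto intro!: prim_Suc rec_eval_comp1[OF rec_eval_proj succ])
qed

lemma computable_add: "computable F \<Longrightarrow> computable G \<Longrightarrow> computable (\<lambda>x. F x + G x)"
  unfolding computable_def using rec_eval_comp2[OF _ _ rec_eval_add] by metis

lemma computable_funpow:
  assumes "computable H"
  shows "computable (\<lambda>x. (H ^^ x) c)"
proof -
  obtain h where h: "\<And>x. rec_eval h [x] (H x)" using assms by (auto simp: computable_def)
  obtain f where f: "\<And>xs. rec_eval f xs c" using rec_eval_const by metis
  have "rec_eval (RPrim f (RComp h [RProj 1])) [n] ((H ^^ n) c)" for n
    by (induction n) (auto intro!: prim_0 f prim_Suc rec_eval_comp1[OF rec_eval_proj h])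
  then show ?thesis unfolding computable_def by blast
qed

lemma computable_mult: "computable G \<Longrightarrow> computable (\<lambda>x. c * G x)"
proof -
  have "((\<lambda>y. y + c) ^^ x) 0 = c * x" for x by (induction x) simp_all
  then have "computable (\<lambda>x. c * x)"
    using computable_funpow[OF computable_add[OF computable_id computable_const], of c 0] by simp
  then show "computable G \<Longrightarrow> computable (\<lambda>x. c * G x)" by (rule computable_comp)
qed

lemma computable_power: "computable (\<lambda>x. c ^ x)"
proof -
  have "((\<lambda>y. c * y) ^^ x) 1 = c ^ x" for x by (induction x) simp_all
  then show ?thesis using computable_funpow[OF computable_mult[OF computable_id], of c 1] by simp
qed

text \<open>Serves pairing: \<open>prod_encode (m, n)\<close> is
  \<open>triangle (m + n) + m\<close>.\<close>

lemma computable_triangle: "computable triangle"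
proof -
  have "rec_eval (RPrim RZero (RComp (RPrim (RProj 0) (RComp RSucc [RProj 1]))
      [RProj 1, RComp RSucc [RProj 0]])) [n] (triangle n)" for n
  proof (induction n)
    case 0 show ?case by (simp add: prim_0 zero)
  next
    case (Suc n)
    show ?case unfolding triangle_Suc
      by (rule prim_Suc[OF Suc.IH rec_eval_comp2[OF rec_eval_proj
        rec_eval_comp1[OF rec_eval_proj succ] rec_eval_add]]) simp_all
  qed
  then show ?thesis unfolding computable_def by blast
qed

lemma computable_prod_encode:
  "computable F \<Longrightarrow> computable G \<Longrightarrow> computable (\<lambda>x. prod_encode (F x, G x))"
  by (simp add: prod_encode_def)
    (intro computable_add computable_comp[OF computable_triangle])

lemma computable_dfa_encode:
  "computable (\<lambda>x. list_encode [a, b, x, prod_encode (0, int_encode (2 * int c ^ x)), d])"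
proof -
  \<comment> \<open>\<open>int_encode\<close> doubles nonnegative integers.\<close>
  have "int_encode (2 * int c ^ x) = 4 * c ^ x" for x
    by (simp add: int_encode_def sum_encode_def nat_mult_distrib nat_power_eq)
  then show ?thesis
    by (simp only: list_encode.simps)
      (intro computable_Suc computable_prod_encode computable_const computable_id computable_mult
        computable_power)
qed

section \<open>Undecidability\<close>

text \<open>
  The entry states are the nonzero even numbers, and \<open>2 x + 1\<close> stands for the state \<open>x\<close> of \<open>F\<close>.
\<close>

definition accept_fun :: "int \<Rightarrow> (int \<Rightarrow> int) \<Rightarrow> int \<Rightarrow> int" where
  "accept_fun c F x =
     (if x mod 2 = 0 then (if x = 0 then 0 else 3 * x + 1)
      else if (x div 2) mod 3 = 1 then (if ((x div 2) div 3) mod c = 0 then 0 else x)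
      else 2 * F (x div 2) + 1)"

lemma fdef_accept_fun:
  assumes "c > 0" "fdef (\<lambda>e. F (e 0))"
  shows "fdef (\<lambda>e. accept_fun c F (e 0))"
  unfolding accept_fun_def
  by (intro fdef_intros fdef_app[of F, OF assms(2)]) (use assms(1) in simp_all)

section \<open>Orbits that end in a fixed point\<close>

lemma rtranclp_funpow: "(\<lambda>x y. y = F x)\<^sup>*\<^sup>* x y \<Longrightarrow> \<exists>n. (F ^^ n) x = y"
proof (induction rule: rtranclp_induct)
  case base show ?case by (rule exI[of _ 0]) simp
next
  case (step y z)
  then obtain n where "(F ^^ n) x = y" by blast
  then show ?case using step(2) by (intro exI[of _ "Suc n"]) simp
qed

lemma funpow_fixpoint: "F z = z \<Longrightarrow> (F ^^ n) z = z"
  by (induction n) simp_all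

text \<open>An orbit stays at a fixed point once there, so the two are compared after
  \<open>m + n\<close> steps.\<close>

lemma funpow_fixpoint_unique:
  assumes "(F ^^ m) x = y" "(F ^^ n) x = z" "F y = y" "F z = z"
  shows "y = z"
proof -
  have "(F ^^ (n + m)) x = y" "(F ^^ (m + n)) x = z"
    unfolding funpow_add using assms funpow_fixpoint by simp_all
  then show ?thesis by (simp add: add.commute)
qed

text \<open>The orbit follows \<open>F\<close> to its exit state, where the test of \<open>w\<close>
  sends it to 0 or freezes it. The condition \<open>v \<noteq> 0\<close> keeps the start away from
  the absorbing 0.\<close>

lemma accept_fun_reaches_0:
  assumes run: "(moves F)\<^sup>*\<^sup>* (3 * v) (3 * w + 1)" and "v \<noteq> 0"
  shows "(\<exists>n. (accept_fun c F ^^ n) (2 * v) = 0) \<longleftrightarrow> w mod c = 0"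
proof -
  let ?H = "accept_fun c F"
  let ?z = "2 * (3 * w + 1) + 1"
  have odd: "(2 * x + 1) div 2 = x" "(2 * x + 1) mod 2 = 1" for x :: int by simp_all
  have "2 * (3 * v) + 1 = ?H (2 * v)" using assms(2) by (simp add: accept_fun_def)
  moreover have "(\<lambda>x y. y = ?H x)\<^sup>*\<^sup>* (2 * (3 * v) + 1) ?z"
    by (rule rtranclp_map[where R = "moves F" and h = "\<lambda>x. 2 * x + 1", OF _ run])
      (simp only: moves_def accept_fun_def odd, simp)
  ultimately have "(\<lambda>x y. y = ?H x)\<^sup>*\<^sup>* (2 * v) ?z"
    by (rule converse_rtranclp_into_rtranclp)
  then obtain n where n: "(?H ^^ n) (2 * v) = ?z"
    using rtranclp_funpow[of ?H] by blast
  have z: "?H ?z = (if w mod c = 0 then 0 else ?z)"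
    unfolding accept_fun_def odd by simp
  have 0: "?H 0 = 0" by (simp add: accept_fun_def)
  show ?thesis
  proof
    assume "w mod c = 0"
    then have "(?H ^^ Suc n) (2 * v) = 0" using n z by simp
    then show "\<exists>n. (?H ^^ n) (2 * v) = 0" by blast
  next
    assume "\<exists>n. (?H ^^ n) (2 * v) = 0"
    then obtain m where m: "(?H ^^ m) (2 * v) = 0" by blast
    show "w mod c = 0"
    proof (rule ccontr)
      assume "w mod c \<noteq> 0"
      \<comment> \<open>After a failed test the exit state is a fixed point; being odd, it differs
        from 0.\<close>
      then have "?z = 0" using funpow_fixpoint_unique[OF n m _ 0] z by simp
      then show False by presburger
    qed
  qed
qed

theorem theorem1:
  shows "\<not> decidable dfa_encode {C. semilinear_dfa (dfa_of C)} (\<lambda>C. language (dfa_of C) = {})"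
proof
  assume "decidable dfa_encode {C. semilinear_dfa (dfa_of C)} (\<lambda>C. language (dfa_of C) = {})"
  then obtain f where f: "\<And>C. semilinear_dfa (dfa_of C) \<Longrightarrow>
      rec_eval f [dfa_encode C] (if language (dfa_of C) = {} then 1 else 0)"
    unfolding decidable_def by blast
  \<comment> \<open>The power of \<open>reg_prime 0\<close> is the Goedel number of the store with
    \<open>x\<close> in register 0 and zeros elsewhere; the factor 2 makes it an entry state of
    \<open>accept_fun\<close>.\<close>
  define E where "E x = list_encode [list_encode [0], list_encode [1], x,
    prod_encode (0, int_encode (2 * int (reg_prime 0) ^ x)), table_encode zero_table]" for x
  have "computable E" unfolding E_def by (rule computable_dfa_encode)
  then obtain g where g: "\<And>x. rec_eval g [x] (E x)" unfolding computable_def by blast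
  obtain p where p: "implements p (RComp f [g]) [0] 1 2"
    using ex_implements[of 1 2 "[0]" "RComp f [g]"] by auto
  \<comment> \<open>Input and answer must show in the Goedel number even if \<open>p\<close> does
    not mention registers 0 and 1.\<close>
  define A where "A = {0, 1} \<union> regs p"
  have A: "finite A" "0 \<in> A" "1 \<in> A" "regs p \<subseteq> A" by (auto simp: A_def finite_regs)
  obtain F where F: "fdef (\<lambda>e. F (e 0))" "simulates A F p" using ex_simulates[OF A(1,4)] by blast
  define H where "H = accept_fun (int (reg_prime 1)) F"
  have "fdef (\<lambda>e. H (e 0))"
    unfolding H_def using fdef_accept_fun F(1) reg_prime_pos[of 1] by simp
  \<comment> \<open>Renaming by \<open>1 - n\<close> swaps variables 0 and 1, since the result comes
    first in \<open>fdef\<close> but second in the transition formula.\<close>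
  then have "pdef (\<lambda>e. e (Suc 0) = H (e 0))"
    using pdef_rename[of "\<lambda>e. e 0 = H (e (Suc 0))" "\<lambda>n. 1 - n"] by (simp add: fdef_def)
  then obtain h where h: "\<And>e. holds e h \<longleftrightarrow> e (Suc 0) = H (e 0)" unfolding pdef_def by blast
  \<comment> \<open>The automaton is started on the code of its own transition table.\<close>
  define x where "x = table_encode [([0, 0, 0], [0], h)]"
  \<comment> \<open>The transition table does not contain the initial state, so \<open>x\<close> is
    fixed before \<open>C\<close> and there is no circularity.\<close>
  define C where "C = iter_code h (2 * int (reg_prime 0) ^ x)"
  define y :: nat where "y = (if language (dfa_of C) = {} then 1 else 0)"
  have "dfa_encode C = E x"
    by (simp add: C_def iter_code_def E_def x_def del: list_encode.simps)
  \<comment> \<open>\<open>C\<close> is a semilinear automaton, so \<open>f\<close> must halt on its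
    code with the correct answer \<open>y\<close>.\<close>
  then have "rec_eval f [E x] y"
    using f[OF semilinear_dfa_iter_code[OF h], of "2 * int (reg_prime 0) ^ x"]
    by (simp add: C_def y_def)
  then have y: "rec_eval (RComp f [g]) [x] y" using g rec_eval_comp1 by blast
  define s where "s = (\<lambda>r::nat. 0::nat)(0 := x)"
  have "exec p s (s(1 := y))" by (rule implementsD[OF p]) (use y in \<open>auto simp: s_def\<close>)
  then have run: "(moves F)\<^sup>*\<^sup>* (3 * int (godel A s)) (3 * int (godel A (s(1 := y))) + 1)"
    using F(2) by (simp add: simulates_def)
  have s: "godel A s = reg_prime 0 ^ x"
    unfolding s_def godel_upd[OF A(1,2)] by simp
  \<comment> \<open>Some word is accepted exactly if the computed answer is nonzero, which by the
    choice of \<open>y\<close> says that no word is.\<close>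
  have "language (dfa_of C) \<noteq> {} \<longleftrightarrow> (\<exists>n. (H ^^ n) (2 * int (reg_prime 0) ^ x) = 0)"
    unfolding C_def by (rule language_iter_code[OF h])
  also have "\<dots> \<longleftrightarrow> int (godel A (s(1 := y))) mod int (reg_prime 1) = 0"
    using accept_fun_reaches_0[OF run] reg_prime_pos[of 0] by (simp add: s H_def)
  also have "\<dots> \<longleftrightarrow> y \<noteq> 0" using godel_mod_eq_0[OF A(1,3)] by simp
  also have "\<dots> \<longleftrightarrow> language (dfa_of C) = {}" by (simp add: y_def)
  finally show False by blast
qed

end
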